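(* For every $\epsilon > 0$ there exists $p_0(\epsilon)$ such that for every prime $p \equiv 1 \pmod{4}$ with $p > p_0(\epsilon)$, \[ \#\{\text{primes } q < p^{\frac{1}{2}+\epsilon} : q^{\ast} \text{ is a biquadratic residue modulo } p\} > p^{\frac{1}{50}\epsilon}. \]
   Context: For an odd prime $q$, $q^{\ast} := (-1)^{(q-1)/2} q$, so that $q^{\ast} = \pm q$ and $q^{\ast} \equiv 1 \pmod 4$. An integer $a$ is a biquadratic residue modulo the prime $p$ if $a \equiv y^4 \pmod{p}$ for some integer $y$ with $p \nmid y$. (The primes $q$ counted are odd primes, since $q^\ast$ is only defined for odd $q$.) *)

theory Defs
  imports Complex_Main "HOL-Number_Theory.Number_Theory"
begin

definition qstar :: "nat \<Rightarrow> int" where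
  "qstar q = (-1) ^ ((q - 1) div 2) * int q"

definition biquad_res :: "int \<Rightarrow> nat \<Rightarrow> bool" where
  "biquad_res a p \<longleftrightarrow> (\<exists>y::int. \<not> int p dvd y \<and> [a = y ^ 4] (mod int p))"

end

theory Submission
  imports Defs "HOL-Computational_Algebra.Polynomial"
begin

text \<open>
  Let \<open>\<chi>\<close> be a quartic character modulo \<open>p\<close> and \<open>J = a + b i\<close> the Jacobi sum \<open>J(\<chi>, \<chi>)\<close>, an
  element of norm \<open>p\<close> in \<open>\<int>[i]\<close>. For a prime \<open>q\<close> the Frobenius map and the identity
  \<open>G\<^sup>4 = J\<^sup>2 p\<close> for the Gauss sum \<open>G\<close> of \<open>\<chi>\<close> express \<open>\<chi>(q*)\<close> modulo \<open>q\<close> as a power of \<open>J\<^sup>2 p\<close>. If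
  \<open>q\<close> divides \<open>f(x) = Im (J (x + i)\<^sup>4)\<close> for some integer \<open>x\<close>, then \<open>J (x + i)\<^sup>4\<close> is rational modulo \<open>q\<close>,
  and that power can be evaluated: \<open>\<chi>(q*) = 1\<close>, so \<open>q*\<close> is a biquadratic residue modulo \<open>p\<close>.

  The values \<open>f(x)\<close> for \<open>x\<close> up to about \<open>p\<close> to the power \<open>\<epsilon> / 4\<close> are below \<open>p\<close> to the power
  \<open>1/2 + \<epsilon>\<close>, and \<open>x\<close> is kept in a residue class modulo 32 for which \<open>32\<close> does not divide \<open>f(x)\<close>.
  A prime power \<open>q\<^sup>k\<close> divides \<open>f(x)\<close> for at most four classes of \<open>x\<close> modulo \<open>q\<^sup>k\<close>, and since the values are
  linear forms in \<open>(a, b)\<close> with large 2 x 2 minors, at most one of them is small. If only few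
  primes divided these values, their product would be too small.
\<close>

subsection \<open>Gaussian integers\<close>

text \<open>The components are kept as explicit integers, so that divisibility by a rational integer
  can be read off componentwise.\<close>

datatype gint = GInt (gre: int) (gim: int)

lemma gint_eqI: "gre x = gre y \<Longrightarrow> gim x = gim y \<Longrightarrow> x = y"
  by (rule gint.expand) simp

lemma gint_eq_iff: "x = y \<longleftrightarrow> gre x = gre y \<and> gim x = gim y"
  by (auto intro: gint_eqI)

instantiation gint :: comm_ring_1
begin

definition zero_gint :: gint where "0 = GInt 0 0"
definition one_gint :: gint where "1 = GInt 1 0"
definition plus_gint :: "gint \<Rightarrow> gint \<Rightarrow> gint" where "x + y = GInt (gre x + gre y) (gim x + gim y)"
definition minus_gint :: "gint \<Rightarrow> gint \<Rightarrow> gint" where "x - y = GInt (gre x - gre y) (gim x - gim y)"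
definition uminus_gint :: "gint \<Rightarrow> gint" where "- x = GInt (- gre x) (- gim x)"
definition times_gint :: "gint \<Rightarrow> gint \<Rightarrow> gint"
  where "x * y = GInt (gre x * gre y - gim x * gim y) (gre x * gim y + gim x * gre y)"

instance
  by intro_classes
    (auto simp: zero_gint_def one_gint_def plus_gint_def minus_gint_def uminus_gint_def
       times_gint_def gint_eq_iff algebra_simps)

end

lemma gint_sel [simp]:
  "gre 0 = 0" "gim 0 = 0" "gre 1 = 1" "gim 1 = 0"
  "gre (x + y) = gre x + gre y" "gim (x + y) = gim x + gim y"
  "gre (x - y) = gre x - gre y" "gim (x - y) = gim x - gim y"
  "gre (- x) = - gre x" "gim (- x) = - gim x"
  "gre (x * y) = gre x * gre y - gim x * gim y"
  "gim (x * y) = gre x * gim y + gim x * gre y"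
  by (auto simp: zero_gint_def one_gint_def plus_gint_def minus_gint_def uminus_gint_def
       times_gint_def)

lemma gint_of_nat [simp]: "gre (of_nat n) = int n" "gim (of_nat n) = 0"
  by (induction n) auto

lemma gint_of_int [simp]: "gre (of_int k) = k" "gim (of_int k) = 0"
  by (cases k; simp)+

lemma gint_numeral [simp]: "gre (numeral n) = numeral n" "gim (numeral n) = 0"
  using gint_of_nat[of "numeral n"] by auto

instance gint :: ring_char_0
proof
  show "inj (of_nat :: nat \<Rightarrow> gint)"
    by (rule injI) (simp add: gint_eq_iff)
qed

definition gnorm :: "gint \<Rightarrow> int" where
  "gnorm x = (gre x)\<^sup>2 + (gim x)\<^sup>2"

lemma gnorm_mult: "gnorm (x * y) = gnorm x * gnorm y"
  by (simp add: gnorm_def power2_eq_square algebra_simps)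

lemma gnorm_eq_0_iff [simp]: "gnorm x = 0 \<longleftrightarrow> x = 0"
  by (auto simp: gnorm_def gint_eq_iff sum_power2_eq_zero_iff)

instance gint :: idom
proof
  fix a b :: gint
  assume "a \<noteq> 0" "b \<noteq> 0"
  then have "gnorm (a * b) \<noteq> 0" by (simp add: gnorm_mult del: gnorm_eq_0_iff) simp
  then show "a * b \<noteq> 0" by simp
qed

definition gcnj :: "gint \<Rightarrow> gint" where
  "gcnj x = GInt (gre x) (- gim x)"

lemma gcnj_sel [simp]: "gre (gcnj x) = gre x" "gim (gcnj x) = - gim x"
  by (simp_all add: gcnj_def)

lemma gcnj_mult: "gcnj (x * y) = gcnj x * gcnj y"
  by (simp add: gint_eq_iff)

lemma gcnj_add: "gcnj (x + y) = gcnj x + gcnj y"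
  by (simp add: gint_eq_iff)

lemma gcnj_diff: "gcnj (x - y) = gcnj x - gcnj y"
  by (simp add: gint_eq_iff)

lemma gcnj_0 [simp]: "gcnj 0 = 0"
  by (simp add: gint_eq_iff)

lemma gcnj_1 [simp]: "gcnj 1 = 1"
  by (simp add: gint_eq_iff)

lemma gcnj_power: "gcnj (x ^ n) = gcnj x ^ n"
  by (induction n) (auto simp: gcnj_mult)

lemma gcnj_sum: "gcnj (sum f A) = (\<Sum>a\<in>A. gcnj (f a))"
  by (induction A rule: infinite_finite_induct) (auto simp: gcnj_add)

lemma gcnj_of_int [simp]: "gcnj (of_int k) = of_int k"
  by (simp add: gint_eq_iff)

lemma mult_gcnj: "x * gcnj x = of_int (gnorm x)"
  by (simp add: gint_eq_iff gnorm_def power2_eq_square algebra_simps)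

lemma of_int_dvd_gint_iff: "of_int q dvd x \<longleftrightarrow> q dvd gre x \<and> q dvd gim x"
proof
  assume "of_int q dvd x"
  then obtain y where "x = of_int q * y" by (elim dvdE)
  then show "q dvd gre x \<and> q dvd gim x" by simp
next
  assume "q dvd gre x \<and> q dvd gim x"
  then obtain u v where "gre x = q * u" "gim x = q * v" by (auto elim!: dvdE)
  then have "x = of_int q * GInt u v" by (simp add: gint_eq_iff)
  then show "of_int q dvd x" by simp
qed

lemma of_nat_dvd_gint_iff: "of_nat q dvd x \<longleftrightarrow> int q dvd gre x \<and> int q dvd gim x"
  using of_int_dvd_gint_iff[of "int q" x] by simp

definition gi :: gint where "gi = GInt 0 1"

lemma gi_sel [simp]: "gre gi = 0" "gim gi = 1"
  by (simp_all add: gi_def)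

lemma gi_square: "gi * gi = - 1"
  by (simp add: gint_eq_iff)

lemma gi_power_2: "gi ^ 2 = - 1"
  by (simp add: power2_eq_square gi_square)

lemma gi_power_4: "gi ^ 4 = 1"
  using gi_power_2 power_mult[of gi 2 2] by simp

lemma gi_power_mod: "gi ^ n = gi ^ (n mod 4)"
proof -
  have "gi ^ n = gi ^ (4 * (n div 4) + n mod 4)" by simp
  also have "\<dots> = (gi ^ 4) ^ (n div 4) * gi ^ (n mod 4)" by (simp only: power_add power_mult)
  finally show ?thesis by (simp add: gi_power_4)
qed

lemma gi_power_3: "gi ^ 3 = - gi"
  by (simp add: power3_eq_cube gi_square)

lemma gi_power_cases: "gi ^ n \<in> {1, gi, - 1, - gi}"
proof -
  have "n mod 4 \<in> {0, 1, 2, 3}" by auto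
  then show ?thesis
    by (subst gi_power_mod) (auto simp: gi_power_2 gi_power_3)
qed

lemma gi_power_eq_1_iff: "gi ^ n = 1 \<longleftrightarrow> 4 dvd n"
proof -
  have "n mod 4 \<in> {0, 1, 2, 3}" by auto
  then have "gi ^ (n mod 4) = 1 \<longleftrightarrow> n mod 4 = 0"
    by (auto simp: gi_power_2 gi_power_3 gint_eq_iff)
  then show ?thesis by (metis gi_power_mod dvd_eq_mod_eq_0)
qed

text \<open>The components of \<open>gi ^ n - 1\<close> have absolute value at most 2, so a divisor
  \<open>q \<ge> 3\<close> forces both to vanish. This is how a congruence modulo \<open>q\<close>
  between character values becomes an equality.\<close>

lemma gi_power_cong_1:
  assumes "of_nat q dvd gi ^ n - 1" "q \<ge> 3"
  shows "gi ^ n = 1"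
proof -
  have *: "\<not> int q dvd 1" "\<not> int q dvd 2" "\<not> int q dvd -1" "\<not> int q dvd -2"
    using assms(2) zdvd_imp_le[of "int q" 1] zdvd_imp_le[of "int q" 2] by auto
  show ?thesis
    using gi_power_cases[of n] assms(1) * by (auto simp: of_nat_dvd_gint_iff)
qed

subsection \<open>Congruences in a commutative ring\<close>

text \<open>Congruence is expressed by divisibility alone, so that one notion serves in
  \<open>gint\<close> modulo a prime and in \<open>gint poly\<close> modulo a prime or modulo
  \<open>cyc p\<close>.\<close>

definition ring_cong :: "'a::comm_ring_1 \<Rightarrow> 'a \<Rightarrow> 'a \<Rightarrow> bool" where
  "ring_cong m x y \<longleftrightarrow> m dvd x - y"

lemma ring_cong_refl [simp]: "ring_cong m x x"
  by (simp add: ring_cong_def)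

lemma ring_cong_sym: "ring_cong m x y \<Longrightarrow> ring_cong m y x"
  unfolding ring_cong_def by (metis dvd_minus_iff minus_diff_eq)

lemma ring_cong_trans [trans]: "ring_cong m x y \<Longrightarrow> ring_cong m y z \<Longrightarrow> ring_cong m x z"
  unfolding ring_cong_def by (metis dvd_add diff_add_cancel add_diff_eq)

lemma ring_cong_add: "ring_cong m x y \<Longrightarrow> ring_cong m x' y' \<Longrightarrow> ring_cong m (x + x') (y + y')"
  unfolding ring_cong_def by (metis dvd_add add_diff_add)

lemma ring_cong_diff: "ring_cong m x y \<Longrightarrow> ring_cong m x' y' \<Longrightarrow> ring_cong m (x - x') (y - y')"
  unfolding ring_cong_def by (metis dvd_diff diff_diff_eq diff_diff_eq2 diff_add_eq add.commute)

lemma ring_cong_mult: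
  assumes "ring_cong m x y" "ring_cong m x' y'"
  shows "ring_cong m (x * x') (y * y')"
proof -
  have "x * x' - y * y' = (x - y) * x' + y * (x' - y')" by (simp add: algebra_simps)
  then show ?thesis using assms unfolding ring_cong_def by simp
qed

lemma ring_cong_power: "ring_cong m x y \<Longrightarrow> ring_cong m (x ^ n) (y ^ n)"
  by (induction n) (auto intro: ring_cong_mult)

lemma ring_cong_sum:
  "(\<And>i. i \<in> A \<Longrightarrow> ring_cong m (f i) (g i)) \<Longrightarrow> ring_cong m (sum f A) (sum g A)"
  by (induction A rule: infinite_finite_induct) (auto intro: ring_cong_add)

text \<open>All inner binomial coefficients are multiples of \<open>q\<close>, so the Frobenius map
  is additive modulo \<open>q\<close>.\<close>

lemma ring_cong_add_power_prime:
  fixes x y :: "'a::comm_ring_1"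
  assumes "prime q"
  shows "ring_cong (of_nat q) ((x + y) ^ q) (x ^ q + y ^ q)"
proof -
  have q: "q > 0" using assms prime_gt_0_nat by blast
  have "(x + y) ^ q = (\<Sum>k\<le>q. of_nat (q choose k) * x ^ k * y ^ (q - k))"
    by (rule binomial_ring)
  also have "{..q} = insert 0 (insert q {1..<q})" using q by auto
  also have "(\<Sum>k\<in>\<dots>. of_nat (q choose k) * x ^ k * y ^ (q - k)) =
      x ^ q + y ^ q + (\<Sum>k\<in>{1..<q}. of_nat (q choose k) * x ^ k * y ^ (q - k))"
    using q by (simp add: sum.insert_if algebra_simps)
  finally have eq: "(x + y) ^ q - (x ^ q + y ^ q) =
      (\<Sum>k\<in>{1..<q}. of_nat (q choose k) * x ^ k * y ^ (q - k))" by simp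
  have "of_nat q dvd (of_nat (q choose k) :: 'a)" if "k \<in> {1..<q}" for k
  proof -
    have "q dvd (q choose k)" using that assms by (intro dvd_choose_prime) auto
    then show ?thesis by (elim dvdE) simp
  qed
  then show ?thesis unfolding ring_cong_def eq
    by (intro dvd_sum) (auto intro!: dvd_mult2)
qed

lemma ring_cong_sum_power_prime:
  fixes f :: "'b \<Rightarrow> 'a::comm_ring_1"
  assumes "prime q"
  shows "ring_cong (of_nat q) ((\<Sum>a\<in>A. f a) ^ q) (\<Sum>a\<in>A. f a ^ q)"
proof (induction A rule: infinite_finite_induct)
  case (insert a A)
  have "ring_cong (of_nat q) ((f a + sum f A) ^ q) (f a ^ q + sum f A ^ q)"
    by (rule ring_cong_add_power_prime[OF assms])
  also have "ring_cong (of_nat q) \<dots> (f a ^ q + (\<Sum>a\<in>A. f a ^ q))"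
    by (intro ring_cong_add ring_cong_refl insert.IH)
  finally show ?case using insert.hyps by simp
qed (use assms prime_gt_0_nat[of q] in \<open>auto simp: zero_power\<close>)

lemma ring_cong_power_prime_minus_1:
  assumes "prime q" "\<not> int q dvd n"
  shows "ring_cong (of_nat q) (of_int n ^ (q - 1)) (1 :: gint)"
proof -
  \<comment> \<open>Fermat's theorem is applied to a natural number; \<open>n\<close> may be
    negative and is first replaced by its residue.\<close>
  define m where "m = nat (n mod int q)"
  have q: "q > 0" using assms(1) prime_gt_0_nat by blast
  then have m: "int m = n mod int q" by (simp add: m_def)
  then have "\<not> q dvd m" using assms(2) by (metis dvd_mod_iff dvd_refl of_nat_dvd_iff)
  from fermat_theorem[OF assms(1) this] have "[int m ^ (q - 1) = 1] (mod int q)"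
    by (metis cong_int_iff of_nat_1 of_nat_power)
  then have "[n ^ (q - 1) = 1] (mod int q)"
    by (simp add: m cong_def power_mod)
  then have "int q dvd n ^ (q - 1) - 1" by (simp add: cong_iff_dvd_diff)
  then have "of_int (int q) dvd (of_int (n ^ (q - 1) - 1) :: gint)"
    unfolding of_int_dvd_gint_iff gint_of_int by simp
  then show ?thesis unfolding ring_cong_def by (simp only: of_int_diff of_int_power of_int_1 of_int_of_nat_eq)
qed

subsection \<open>Multiplicative characters and Jacobi sums\<close>

text \<open>For prime \<open>p\<close> these are the Dirichlet characters modulo \<open>p\<close>
  with values in the Gaussian integers, as functions on all of \<open>int\<close>.\<close>

definition mult_char :: "nat \<Rightarrow> (int \<Rightarrow> gint) \<Rightarrow> bool" where
  "mult_char p \<alpha> \<longleftrightarrow> (\<forall>a b. \<alpha> (a * b) = \<alpha> a * \<alpha> b) \<and> (\<forall>a. \<alpha> (a mod int p) = \<alpha> a) \<and>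
     (\<forall>a. \<alpha> a = 0 \<longleftrightarrow> int p dvd a)"

text \<open>Cyclic convolution on the residues modulo \<open>p\<close>. At \<open>n = 1\<close> it
  is the Jacobi sum; as a function of \<open>n\<close> it gives the coefficients of a product of two
  Gauss sums.\<close>

definition conv :: "nat \<Rightarrow> (int \<Rightarrow> gint) \<Rightarrow> (int \<Rightarrow> gint) \<Rightarrow> int \<Rightarrow> gint" where
  "conv p F H n = (\<Sum>a\<in>{0..<int p}. F a * H (n - a))"

abbreviation jacobi_sum :: "nat \<Rightarrow> (int \<Rightarrow> gint) \<Rightarrow> (int \<Rightarrow> gint) \<Rightarrow> gint" where
  "jacobi_sum p \<alpha> \<beta> \<equiv> conv p \<alpha> \<beta> 1"

lemma mult_char_mult: "mult_char p \<alpha> \<Longrightarrow> \<alpha> (a * b) = \<alpha> a * \<alpha> b"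
  by (simp add: mult_char_def)

lemma mult_char_mod: "mult_char p \<alpha> \<Longrightarrow> \<alpha> (a mod int p) = \<alpha> a"
  by (simp add: mult_char_def)

lemma mult_char_eq_0_iff: "mult_char p \<alpha> \<Longrightarrow> \<alpha> a = 0 \<longleftrightarrow> int p dvd a"
  by (simp add: mult_char_def)

lemma mult_char_cong: "mult_char p \<alpha> \<Longrightarrow> a mod int p = b mod int p \<Longrightarrow> \<alpha> a = \<alpha> b"
  by (metis mult_char_mod)

lemma mult_char_1:
  assumes "mult_char p \<alpha>" "p > 1"
  shows "\<alpha> 1 = 1"
proof -
  have "\<alpha> 1 * \<alpha> 1 = \<alpha> 1 * 1" using mult_char_mult[OF assms(1), of 1 1] by simp
  moreover have "\<alpha> 1 \<noteq> 0" using assms by (simp add: mult_char_eq_0_iff[OF assms(1)])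
  ultimately show ?thesis by (simp only: mult_cancel_left) simp
qed

lemma mult_char_minus_1_square:
  assumes "mult_char p \<alpha>" "p > 1"
  shows "\<alpha> (-1) * \<alpha> (-1) = 1"
  using mult_char_mult[OF assms(1), of "-1" "-1"] mult_char_1[OF assms] by simp

lemma mult_char_power:
  "mult_char p \<alpha> \<Longrightarrow> k > 0 \<Longrightarrow> mult_char p (\<lambda>a. \<alpha> a ^ k)"
  by (simp add: mult_char_def power_mult_distrib)

lemma bij_betw_add_mod:
  assumes "p > 0"
  shows "bij_betw (\<lambda>b. (c + b) mod int p) {0..<int p} {0..<int p}"
proof -
  have "inj_on (\<lambda>b. (c + b) mod int p) {0..<int p}"
  proof (rule inj_onI)
    fix x y assume xy: "x \<in> {0..<int p}" "y \<in> {0..<int p}" "(c + x) mod int p = (c + y) mod int p"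
    then have "x mod int p = y mod int p"
      by (metis add_diff_cancel_left' mod_diff_left_eq)
    then show "x = y" using xy by simp
  qed
  moreover have "(\<lambda>b. (c + b) mod int p) ` {0..<int p} \<subseteq> {0..<int p}" using assms by auto
  ultimately show ?thesis unfolding bij_betw_def
    by (metis endo_inj_surj finite_atLeastLessThan_int)
qed

lemma bij_betw_mult_mod:
  assumes "prime p" "\<not> int p dvd c"
  shows "bij_betw (\<lambda>b. (c * b) mod int p) {0..<int p} {0..<int p}"
proof -
  have "p > 0" using assms(1) prime_gt_0_nat by blast
  have "inj_on (\<lambda>b. (c * b) mod int p) {0..<int p}"
  proof (rule inj_onI)
    fix x y assume xy: "x \<in> {0..<int p}" "y \<in> {0..<int p}" "(c * x) mod int p = (c * y) mod int p"
    then have "int p dvd c * (x - y)" by (metis mod_eq_dvd_iff right_diff_distrib)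
    then have "int p dvd x - y" using assms by (simp add: prime_dvd_mult_iff)
    then have "x mod int p = y mod int p" by (simp add: mod_eq_dvd_iff)
    then show "x = y" using xy by simp
  qed
  moreover have "(\<lambda>b. (c * b) mod int p) ` {0..<int p} \<subseteq> {0..<int p}" using \<open>p > 0\<close> by auto
  ultimately show ?thesis unfolding bij_betw_def
    by (metis endo_inj_surj finite_atLeastLessThan_int)
qed

lemma sum_shift_mod:
  assumes "p > 0" "\<And>a. F (a mod int p) = F a"
  shows "(\<Sum>a\<in>{0..<int p}. F (c + a)) = (\<Sum>a\<in>{0..<int p}. F a)"
  using sum.reindex_bij_betw[OF bij_betw_add_mod[OF assms(1), of c], of F] by (simp add: assms(2))

lemma sum_dilate_mod:
  assumes "prime p" "\<not> int p dvd c" "\<And>a. F (a mod int p) = F a"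
  shows "(\<Sum>a\<in>{0..<int p}. F (c * a)) = (\<Sum>a\<in>{0..<int p}. F a)"
  using sum.reindex_bij_betw[OF bij_betw_mult_mod[OF assms(1,2)], of F] by (simp add: assms(3))

text \<open>Multiplication by \<open>c\<close> permutes the residues, so the sum is
  \<open>\<alpha> c\<close> times itself.\<close>

lemma sum_mult_char_eq_0:
  assumes "prime p" "mult_char p \<alpha>" "\<alpha> c \<noteq> 1" "\<not> int p dvd c"
  shows "(\<Sum>a\<in>{0..<int p}. \<alpha> a) = 0"
proof -
  have "(\<Sum>a\<in>{0..<int p}. \<alpha> (c * a)) = (\<Sum>a\<in>{0..<int p}. \<alpha> a)"
    by (rule sum_dilate_mod[OF assms(1,4)]) (rule mult_char_mod[OF assms(2)])
  then have "\<alpha> c * (\<Sum>a\<in>{0..<int p}. \<alpha> a) = 1 * (\<Sum>a\<in>{0..<int p}. \<alpha> a)"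
    by (simp add: mult_char_mult[OF assms(2)] sum_distrib_left)
  then show ?thesis using assms(3) by (simp only: mult_cancel_right) simp
qed

lemma sum_indicator_nonzero_mod:
  assumes "p > 0"
  shows "(\<Sum>a\<in>{0..<int p}. if int p dvd a then 0 else c) = (of_nat (p - 1) * c :: gint)"
proof -
  have "{1..<int p} = {a\<in>{0..<int p}. \<not> int p dvd a}"
    using zdvd_not_zless[of _ "int p"] by (auto simp: order_le_less)
  then have "(\<Sum>a\<in>{0..<int p}. if int p dvd a then 0 else c) = (\<Sum>a\<in>{1..<int p}. c)"
    by (simp add: sum.inter_filter[symmetric] if_not_P sum.If_cases Int_def Compl_eq)
  moreover have "nat (int p - 1) = p - 1" by simp
  ultimately show ?thesis by simp
qed

lemma mult_char_diff_mod:
  "mult_char p \<alpha> \<Longrightarrow> \<alpha> (n - a mod int p) = \<alpha> (n - a)"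
  by (erule mult_char_cong) (rule mod_diff_right_eq)

text \<open>The substitution of \<open>n * a\<close> for \<open>a\<close> pulls
  \<open>\<alpha> n * \<beta> n\<close> out of the sum and leaves the Jacobi sum.\<close>

lemma conv_mult_char:
  assumes "prime p" "mult_char p \<alpha>" "mult_char p \<beta>" "\<not> int p dvd n"
  shows "conv p \<alpha> \<beta> n = jacobi_sum p \<alpha> \<beta> * (\<alpha> n * \<beta> n)"
proof -
  have "conv p \<alpha> \<beta> n = (\<Sum>a\<in>{0..<int p}. \<alpha> (n * a) * \<beta> (n - n * a))"
    unfolding conv_def
    by (rule sum_dilate_mod[OF assms(1,4), symmetric])
      (simp add: mult_char_mod[OF assms(2)] mult_char_diff_mod[OF assms(3)])
  also have "\<dots> = (\<Sum>a\<in>{0..<int p}. \<alpha> a * \<beta> (1 - a) * (\<alpha> n * \<beta> n))"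
  proof (rule sum.cong[OF refl])
    fix a
    have "n - n * a = n * (1 - a)" by (simp add: algebra_simps)
    then show "\<alpha> (n * a) * \<beta> (n - n * a) = \<alpha> a * \<beta> (1 - a) * (\<alpha> n * \<beta> n)"
      by (simp add: mult_char_mult[OF assms(2)] mult_char_mult[OF assms(3)])
  qed
  finally show ?thesis by (simp add: conv_def sum_distrib_right)
qed

lemma conv_mult_char_0:
  assumes "mult_char p \<alpha>" "mult_char p \<beta>" "int p dvd n"
  shows "conv p \<alpha> \<beta> n = \<beta> (-1) * (\<Sum>a\<in>{0..<int p}. \<alpha> a * \<beta> a)"
proof -
  have "\<beta> (n - a) = \<beta> (-1) * \<beta> a" for a
  proof -
    have "\<beta> (n - a) = \<beta> ((-1) * a)"
      by (rule mult_char_cong[OF assms(2)]) (use assms(3) in \<open>simp add: mod_eq_dvd_iff\<close>)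
    then show ?thesis by (simp only: mult_char_mult[OF assms(2)])
  qed
  then show ?thesis by (simp add: conv_def sum_distrib_left algebra_simps)
qed

lemma sum_conv:
  assumes "p > 0" "mult_char p \<beta>"
  shows "(\<Sum>n\<in>{0..<int p}. conv p \<alpha> \<beta> n) =
     (\<Sum>a\<in>{0..<int p}. \<alpha> a) * (\<Sum>a\<in>{0..<int p}. \<beta> a)"
proof -
  have "(\<Sum>n\<in>{0..<int p}. \<beta> (n - a)) = (\<Sum>n\<in>{0..<int p}. \<beta> n)" for a
    using sum_shift_mod[of p \<beta> "-a"] assms(1) mult_char_mod[OF assms(2)] by simp
  then show ?thesis
    unfolding conv_def by (subst sum.swap) (simp add: sum_distrib_left[symmetric] sum_distrib_right)
qed

text \<open>The sum of \<open>conv p \<alpha> \<beta> n\<close> over all residues \<open>n\<close>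
  factors into two character sums and hence vanishes. The residue 0 contributes
  \<open>\<beta> (-1)\<close> times \<open>p - 1\<close>, and each of the other \<open>p - 1\<close>
  residues contributes the Jacobi sum.\<close>

lemma jacobi_sum_inverse:
  assumes "prime p" "mult_char p \<alpha>" "mult_char p \<beta>" "(\<Sum>a\<in>{0..<int p}. \<alpha> a) = 0"
    and inv: "\<And>a. \<not> int p dvd a \<Longrightarrow> \<alpha> a * \<beta> a = 1"
  shows "jacobi_sum p \<alpha> \<beta> = - \<beta> (-1)"
proof -
  have p: "p > 1" "p > 0" using assms(1) prime_gt_1_nat prime_gt_0_nat by auto
  let ?J = "jacobi_sum p \<alpha> \<beta>"
  have sum_ab: "(\<Sum>a\<in>{0..<int p}. \<alpha> a * \<beta> a) = of_nat (p - 1)"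
  proof -
    have "(\<Sum>a\<in>{0..<int p}. \<alpha> a * \<beta> a) = (\<Sum>a\<in>{0..<int p}. if int p dvd a then 0 else 1)"
      by (rule sum.cong) (auto simp: inv mult_char_eq_0_iff[OF assms(2)])
    then show ?thesis using sum_indicator_nonzero_mod[OF p(2), of 1] by simp
  qed
  have "0 = (\<Sum>n\<in>{0..<int p}. conv p \<alpha> \<beta> n)"
    by (simp add: sum_conv[OF p(2) assms(3)] assms(4))
  also have "\<dots> = (\<Sum>n\<in>{0..<int p}. (if n = 0 then \<beta> (-1) * of_nat (p - 1) else 0) +
                     (if int p dvd n then 0 else ?J))"
  proof (rule sum.cong[OF refl])
    fix n assume "n \<in> {0..<int p}"
    then have n: "int p dvd n \<longleftrightarrow> n = 0" using zdvd_imp_le by force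
    show "conv p \<alpha> \<beta> n = (if n = 0 then \<beta> (-1) * of_nat (p - 1) else 0) +
                     (if int p dvd n then 0 else ?J)"
      using n conv_mult_char[OF assms(1-3), of n] inv[of n] conv_mult_char_0[OF assms(2,3), of n] sum_ab
      by (cases "n = 0") auto
  qed
  also have "\<dots> = of_nat (p - 1) * (\<beta> (-1) + ?J)"
    using p sum_indicator_nonzero_mod[OF p(2), of ?J]
    by (simp add: sum.distrib sum.delta algebra_simps)
  finally have "\<beta> (-1) + ?J = 0" using p by simp
  then show ?thesis by (metis add.commute eq_neg_iff_add_eq_0)
qed

subsection \<open>Gauss sums as polynomials modulo \<open>x\<^sup>p - 1\<close>\<close>

text \<open>The Gauss sum of \<open>F\<close> with the root of unity replaced by an indeterminate.
  Working modulo \<open>cyc p\<close> takes the place of adjoining a \<open>p\<close>-th root of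
  unity to the Gaussian integers.\<close>

definition gpol :: "nat \<Rightarrow> (int \<Rightarrow> gint) \<Rightarrow> gint poly" where
  "gpol p F = (\<Sum>n\<in>{0..<int p}. monom (F n) (nat n))"

abbreviation cyc :: "nat \<Rightarrow> gint poly" where
  "cyc p \<equiv> monom 1 p - 1"

lemma ring_cong_monom_mod: "ring_cong (cyc p) (monom c n) (monom c (n mod p))"
proof -
  have "ring_cong (cyc p) (monom 1 p) 1" by (simp add: ring_cong_def)
  then have "ring_cong (cyc p) (monom 1 p ^ (n div p)) (1 ^ (n div p))" by (rule ring_cong_power)
  then have "ring_cong (cyc p) (monom 1 p ^ (n div p) * monom c (n mod p)) (1 ^ (n div p) * monom c (n mod p))"
    by (rule ring_cong_mult) simp
  then show ?thesis by (simp add: monom_power mult_monom mult.commute)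
qed

lemma gpol_cong: "(\<And>n. n \<in> {0..<int p} \<Longrightarrow> F n = H n) \<Longrightarrow> gpol p F = gpol p H"
  unfolding gpol_def by (rule sum.cong) auto

lemma gpol_smult: "gpol p (\<lambda>n. c * F n) = smult c (gpol p F)"
proof -
  have "smult c (gpol p F) = [:c:] * gpol p F" by simp
  also have "\<dots> = gpol p (\<lambda>n. c * F n)"
    unfolding gpol_def sum_distrib_left by (simp add: smult_monom)
  finally show ?thesis by simp
qed

lemma gpol_diff: "gpol p (\<lambda>n. F n - H n) = gpol p F - gpol p H"
  by (simp add: gpol_def sum_subtractf diff_monom[symmetric])

lemma gpol_indicator_0: "p > 0 \<Longrightarrow> gpol p (\<lambda>n. if n = 0 then c else 0) = [:c:]"
proof -
  assume p: "p > 0"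
  have "gpol p (\<lambda>n. if n = 0 then c else 0) = (\<Sum>n\<in>{0..<int p}. if n = 0 then monom c 0 else 0)"
    unfolding gpol_def by (rule sum.cong) auto
  then show ?thesis using p by (simp add: sum.delta monom_0)
qed

text \<open>Since exponents count only modulo \<open>p\<close>, the product of the two polynomials
  has the cyclic convolution as coefficients.\<close>

lemma gpol_mult:
  assumes "p > 0" "\<And>a. H (a mod int p) = H a"
  shows "ring_cong (cyc p) (gpol p F * gpol p H) (gpol p (conv p F H))"
proof -
  have "gpol p F * gpol p H =
      (\<Sum>a\<in>{0..<int p}. \<Sum>b\<in>{0..<int p}. monom (F a * H b) (nat a + nat b))"
    by (simp add: gpol_def sum_product mult_monom)
  also have "ring_cong (cyc p) \<dots> (\<Sum>a\<in>{0..<int p}. \<Sum>n\<in>{0..<int p}. monom (F a * H (n - a)) (nat n))"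
  proof (rule ring_cong_sum)
    fix a assume a: "a \<in> {0..<int p}"
    have "ring_cong (cyc p) (\<Sum>b\<in>{0..<int p}. monom (F a * H b) (nat a + nat b))
       (\<Sum>b\<in>{0..<int p}. monom (F a * H ((a + b) mod int p - a)) (nat ((a + b) mod int p)))"
    proof (rule ring_cong_sum)
      fix b assume b: "b \<in> {0..<int p}"
      have "nat ((a + b) mod int p) = (nat a + nat b) mod p"
        using a b by (metis atLeastLessThan_iff nat_add_distrib nat_int nat_mod_distrib of_nat_0_le_iff add_nonneg_nonneg)
      moreover have "H ((a + b) mod int p - a) = H b"
      proof -
        have "((a + b) mod int p - a) mod int p = b mod int p" by (simp add: mod_simps)
        then show ?thesis by (metis assms(2))
      qed
      ultimately show "ring_cong (cyc p) (monom (F a * H b) (nat a + nat b))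
         (monom (F a * H ((a + b) mod int p - a)) (nat ((a + b) mod int p)))"
        by (simp add: ring_cong_monom_mod)
    qed
    also have "(\<Sum>b\<in>{0..<int p}. monom (F a * H ((a + b) mod int p - a)) (nat ((a + b) mod int p)))
       = (\<Sum>n\<in>{0..<int p}. monom (F a * H (n - a)) (nat n))"
      by (rule sum.reindex_bij_betw[OF bij_betw_add_mod[OF assms(1), of a],
            of "\<lambda>n. monom (F a * H (n - a)) (nat n)"])
    finally show "ring_cong (cyc p) (\<Sum>b\<in>{0..<int p}. monom (F a * H b) (nat a + nat b))
       (\<Sum>n\<in>{0..<int p}. monom (F a * H (n - a)) (nat n))" .
  qed
  also have "(\<Sum>a\<in>{0..<int p}. \<Sum>n\<in>{0..<int p}. monom (F a * H (n - a)) (nat n)) = gpol p (conv p F H)"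
    unfolding gpol_def conv_def by (subst sum.swap) (simp add: monom_sum)
  finally show ?thesis .
qed

text \<open>The classical relation between Gauss and Jacobi sums. The vanishing of the last sum
  makes the convolution zero at the residue 0, so it is a multiple of
  \<open>\<alpha> a * \<beta> a\<close> everywhere.\<close>

lemma gpol_mult_char:
  assumes "prime p" "mult_char p \<alpha>" "mult_char p \<beta>"
    and "(\<Sum>a\<in>{0..<int p}. \<alpha> a * \<beta> a) = 0"
  shows "ring_cong (cyc p) (gpol p \<alpha> * gpol p \<beta>)
     (smult (jacobi_sum p \<alpha> \<beta>) (gpol p (\<lambda>a. \<alpha> a * \<beta> a)))"
proof -
  have "ring_cong (cyc p) (gpol p \<alpha> * gpol p \<beta>) (gpol p (conv p \<alpha> \<beta>))"
    using assms(1) by (intro gpol_mult) (auto simp: prime_gt_0_nat mult_char_mod[OF assms(3)])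
  also have "gpol p (conv p \<alpha> \<beta>) = gpol p (\<lambda>a. jacobi_sum p \<alpha> \<beta> * (\<alpha> a * \<beta> a))"
  proof (rule gpol_cong)
    fix n
    show "conv p \<alpha> \<beta> n = jacobi_sum p \<alpha> \<beta> * (\<alpha> n * \<beta> n)"
    proof (cases "int p dvd n")
      case True
      then have "\<alpha> n = 0" using mult_char_eq_0_iff[OF assms(2)] by simp
      then show ?thesis using conv_mult_char_0[OF assms(2,3) True] assms(4) by simp
    next
      case False
      then show ?thesis using conv_mult_char[OF assms(1-3)] by simp
    qed
  qed
  finally show ?thesis by (simp add: gpol_smult)
qed

text \<open>The classical product of the Gauss sums of two inverse characters. The correction
  \<open>gpol p (\<lambda>_. 1)\<close> is \<open>1 + x + ... + x^(p-1)\<close>, which vanishes at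
  primitive \<open>p\<close>-th roots of unity but not modulo \<open>cyc p\<close>.\<close>

lemma gpol_mult_char_inverse:
  assumes "prime p" "mult_char p \<alpha>" "mult_char p \<beta>" "(\<Sum>a\<in>{0..<int p}. \<alpha> a) = 0"
    and inv: "\<And>a. \<not> int p dvd a \<Longrightarrow> \<alpha> a * \<beta> a = 1"
  shows "ring_cong (cyc p) (gpol p \<alpha> * gpol p \<beta>)
     (smult (\<beta> (-1)) ([:of_nat p:] - gpol p (\<lambda>_. 1)))"
proof -
  have p: "p > 0" using assms(1) prime_gt_0_nat by blast
  have sum_ab: "(\<Sum>a\<in>{0..<int p}. \<alpha> a * \<beta> a) = of_nat (p - 1)"
  proof -
    have "(\<Sum>a\<in>{0..<int p}. \<alpha> a * \<beta> a) = (\<Sum>a\<in>{0..<int p}. if int p dvd a then 0 else 1)"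
      by (rule sum.cong) (auto simp: inv mult_char_eq_0_iff[OF assms(2)])
    then show ?thesis using sum_indicator_nonzero_mod[OF p, of 1] by simp
  qed
  have "ring_cong (cyc p) (gpol p \<alpha> * gpol p \<beta>) (gpol p (conv p \<alpha> \<beta>))"
    using p by (intro gpol_mult) (auto simp: mult_char_mod[OF assms(3)])
  also have "gpol p (conv p \<alpha> \<beta>) = gpol p (\<lambda>n. \<beta> (-1) * ((if n = 0 then of_nat p else 0) - 1))"
  proof (rule gpol_cong)
    fix n assume "n \<in> {0..<int p}"
    then have n: "int p dvd n \<longleftrightarrow> n = 0" using zdvd_imp_le by force
    show "conv p \<alpha> \<beta> n = \<beta> (-1) * ((if n = 0 then of_nat p else 0) - 1)"
    proof (cases "n = 0")
      case True
      then show ?thesis using conv_mult_char_0[OF assms(2,3), of n] sum_ab p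
        by (simp add: of_nat_diff)
    next
      case False
      then show ?thesis using conv_mult_char[OF assms(1-3), of n] n inv[of n] jacobi_sum_inverse[OF assms]
        by simp
    qed
  qed
  finally show ?thesis by (simp add: gpol_smult gpol_diff gpol_indicator_0[OF p])
qed

text \<open>In particular the all-ones polynomial annihilates, modulo \<open>cyc p\<close>, every
  \<open>gpol p F\<close> whose values sum to zero.\<close>

lemma gpol_mult_const:
  assumes "p > 0"
  shows "ring_cong (cyc p) (gpol p F * gpol p (\<lambda>_. 1)) (smult (\<Sum>a\<in>{0..<int p}. F a) (gpol p (\<lambda>_. 1)))"
proof -
  have "conv p F (\<lambda>_. 1) = (\<lambda>_. (\<Sum>a\<in>{0..<int p}. F a) * 1)" by (simp add: conv_def fun_eq_iff)
  then show ?thesis using gpol_mult[OF assms, of "\<lambda>_. 1" F] gpol_smult[of p "\<Sum>a\<in>{0..<int p}. F a" "\<lambda>_. 1"]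
    by simp
qed

subsection \<open>The coefficient of \<open>x\<close> modulo \<open>x\<^sup>p - 1\<close>\<close>

text \<open>Adding up all exponents congruent to 1 gives a linear functional on all polynomials that
  depends only on the class modulo \<open>cyc p\<close>. It recovers \<open>F 1\<close> from
  \<open>gpol p F\<close>, and so turns relations between Gauss sums into relations between
  scalars.\<close>

definition cyc_coeff :: "nat \<Rightarrow> gint poly \<Rightarrow> gint" where
  "cyc_coeff p P = (\<Sum>k\<le>degree P. if k mod p = 1 then coeff P k else 0)"

lemma cyc_coeff_bound:
  assumes "degree P \<le> M"
  shows "cyc_coeff p P = (\<Sum>k\<le>M. if k mod p = 1 then coeff P k else 0)"
  unfolding cyc_coeff_def
  by (rule sum.mono_neutral_left) (use assms in \<open>auto simp: coeff_eq_0\<close>)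

lemma cyc_coeff_add: "cyc_coeff p (P + Q) = cyc_coeff p P + cyc_coeff p Q"
proof -
  let ?M = "max (degree P) (degree Q)"
  have "cyc_coeff p (P + Q) = (\<Sum>k\<le>?M. if k mod p = 1 then coeff (P + Q) k else 0)"
    by (rule cyc_coeff_bound) (rule degree_add_le_max)
  moreover have "cyc_coeff p P = (\<Sum>k\<le>?M. if k mod p = 1 then coeff P k else 0)"
    by (rule cyc_coeff_bound) simp
  moreover have "cyc_coeff p Q = (\<Sum>k\<le>?M. if k mod p = 1 then coeff Q k else 0)"
    by (rule cyc_coeff_bound) simp
  ultimately show ?thesis by (simp add: sum.distrib[symmetric] if_distrib cong: if_cong)
qed

lemma cyc_coeff_smult: "cyc_coeff p (smult c P) = c * cyc_coeff p P"
proof -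
  have "cyc_coeff p (smult c P) = (\<Sum>k\<le>degree P. if k mod p = 1 then coeff (smult c P) k else 0)"
    by (rule cyc_coeff_bound) (rule degree_smult_le)
  then show ?thesis by (simp add: cyc_coeff_def sum_distrib_left if_distrib cong: if_cong)
qed

lemma cyc_coeff_diff: "cyc_coeff p (P - Q) = cyc_coeff p P - cyc_coeff p Q"
  using cyc_coeff_add[of p P "smult (-1) Q"] cyc_coeff_smult[of p "-1" Q] by simp

lemma cyc_coeff_0 [simp]: "cyc_coeff p 0 = 0"
  by (simp add: cyc_coeff_def)

lemma cyc_coeff_sum: "cyc_coeff p (\<Sum>a\<in>A. P a) = (\<Sum>a\<in>A. cyc_coeff p (P a))"
  by (induction A rule: infinite_finite_induct) (auto simp: cyc_coeff_add)

lemma cyc_coeff_monom: "cyc_coeff p (monom c n) = (if n mod p = 1 then c else 0)"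
proof -
  have "cyc_coeff p (monom c n) = (\<Sum>k\<le>n. if k mod p = 1 then coeff (monom c n) k else 0)"
    by (rule cyc_coeff_bound) (rule degree_monom_le)
  also have "\<dots> = (\<Sum>k\<le>n. if k = n then (if n mod p = 1 then c else 0) else 0)"
    by (rule sum.cong) auto
  finally show ?thesis by simp
qed

text \<open>In a multiple of \<open>cyc p\<close> each monomial of exponent \<open>i\<close> is
  cancelled by one of exponent \<open>i + p\<close>, and both exponents have the same
  residue.\<close>

lemma cyc_coeff_ring_cong:
  assumes "ring_cong (cyc p) P Q"
  shows "cyc_coeff p P = cyc_coeff p Q"
proof -
  obtain H where H: "P - Q = cyc p * H" using assms by (auto simp: ring_cong_def elim: dvdE)
  have "cyc p * H = (\<Sum>i\<le>degree H. cyc p * monom (coeff H i) i)"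
    by (subst poly_as_sum_of_monoms[symmetric]) (simp add: sum_distrib_left)
  also have "cyc_coeff p \<dots> = 0"
    by (simp add: cyc_coeff_sum algebra_simps mult_monom cyc_coeff_diff cyc_coeff_monom)
  finally show ?thesis using H cyc_coeff_diff[of p P Q] by simp
qed

lemma cyc_coeff_ring_cong_of_nat:
  assumes "ring_cong (of_nat q) P Q"
  shows "ring_cong (of_nat q) (cyc_coeff p P) (cyc_coeff p Q)"
proof -
  obtain H where "P - Q = of_nat q * H" using assms by (auto simp: ring_cong_def elim: dvdE)
  then have "P - Q = smult (of_nat q) H" by (simp add: of_nat_poly)
  then show ?thesis using cyc_coeff_diff[of p P Q] cyc_coeff_smult[of p "of_nat q" H]
    unfolding ring_cong_def by (metis dvd_triv_left)
qed

lemma cyc_coeff_gpol: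
  assumes "p > 1"
  shows "cyc_coeff p (gpol p F) = F 1"
proof -
  have "cyc_coeff p (gpol p F) = (\<Sum>n\<in>{0..<int p}. if n = 1 then F 1 else 0)"
    unfolding gpol_def cyc_coeff_sum
    by (rule sum.cong) (auto simp: cyc_coeff_monom nat_eq_iff)
  then show ?thesis using assms by simp
qed

subsection \<open>The quartic character\<close>

lemma residue_primroot_discrete_log:
  assumes "prime p" "residue_primroot p g" "\<not> int p dvd n"
  shows "\<exists>e. [int g ^ e = n] (mod int p)"
proof -
  have p: "p > 0" "p > 1" using assms(1) prime_gt_0_nat prime_gt_1_nat by auto
  define m where "m = nat (n mod int p)"
  have m: "int m = n mod int p" using p by (simp add: m_def)
  have "m \<noteq> 0" using assms(3) m by (metis dvd_eq_mod_eq_0 of_nat_0)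
  moreover have "m < p" using m p by (metis of_nat_less_iff pos_mod_bound of_nat_0_less_iff)
  ultimately have "m \<in> totatives p" using assms(1) by (auto simp: totatives_prime)
  also have "totatives p = (\<lambda>i. g ^ i mod p) ` {..<totient p}"
    using residue_primroot_is_generator[of p g] p assms(2) by (simp add: bij_betw_def)
  finally obtain i where "m = g ^ i mod p" by auto
  then have "[int g ^ i = int m] (mod int p)"
    by (metis cong_int_iff cong_mod_left cong_refl of_nat_power)
  then show ?thesis using m by (auto simp: cong_def)
qed

definition dlog :: "nat \<Rightarrow> nat \<Rightarrow> int \<Rightarrow> nat" where
  "dlog p g n = (SOME e. [int g ^ e = n] (mod int p))"

lemma dlog:
  assumes "prime p" "residue_primroot p g" "\<not> int p dvd n"
  shows "[int g ^ dlog p g n = n] (mod int p)"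
  unfolding dlog_def by (rule someI_ex) (rule residue_primroot_discrete_log[OF assms])

lemma dlog_mod: "dlog p g (n mod int p) = dlog p g n"
  by (simp add: dlog_def cong_def)

lemma residue_primroot_power_cong:
  assumes "prime p" "residue_primroot p g"
  shows "[int g ^ a = int g ^ b] (mod int p) \<longleftrightarrow> [a = b] (mod (p - 1))"
proof -
  have "[int g ^ a = int g ^ b] (mod int p) \<longleftrightarrow> [g ^ a = g ^ b] (mod p)"
    by (metis cong_int_iff of_nat_power)
  also have "\<dots> \<longleftrightarrow> [a = b] (mod (ord p g))"
    using assms(2) by (intro order_divides_expdiff) (auto simp: residue_primroot_def)
  finally show ?thesis using assms by (simp add: residue_primroot_def totient_prime)
qed

definition quartic_char :: "nat \<Rightarrow> nat \<Rightarrow> int \<Rightarrow> gint" where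
  "quartic_char p g n = (if int p dvd n then 0 else gi ^ dlog p g n)"

locale quartic_setup =
  fixes p g :: nat
  assumes prime_p: "prime p" and p_mod_4: "[p = 1] (mod 4)" and primroot: "residue_primroot p g"
begin

abbreviation chi :: "int \<Rightarrow> gint" where "chi \<equiv> quartic_char p g"

lemma p_gt_1: "p > 1"
  using prime_p prime_gt_1_nat by blast

lemma four_dvd: "4 dvd p - 1"
  using p_mod_4 p_gt_1 by (simp add: cong_altdef_nat cong_sym_eq)

text \<open>The index of \<open>n\<close> is determined modulo \<open>p - 1\<close>, a multiple of 4
  because \<open>p\<close> is 1 modulo 4. Hence the power of \<open>gi\<close> does not depend on
  which index \<open>dlog\<close> picks.\<close>

lemma chi_eq_gi_power:
  assumes "[int g ^ e = n] (mod int p)"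
  shows "chi n = gi ^ e"
proof -
  have "coprime p g" using primroot by (simp add: residue_primroot_def)
  then have "\<not> p dvd g ^ e"
    using prime_p by (metis coprime_common_divisor dvd_refl not_prime_unit prime_dvd_power)
  then have "\<not> int p dvd int g ^ e" by (metis of_nat_dvd_iff of_nat_power)
  then have n: "\<not> int p dvd n" using assms by (metis cong_dvd_iff)
  have "[int g ^ dlog p g n = int g ^ e] (mod int p)"
    using dlog[OF prime_p primroot n] assms by (metis cong_trans cong_sym)
  then have "[dlog p g n = e] (mod (p - 1))"
    using residue_primroot_power_cong[OF prime_p primroot] by simp
  then have "[dlog p g n = e] (mod 4)" using four_dvd by (rule cong_dvd_modulus_nat)
  then have "gi ^ dlog p g n = gi ^ e" by (metis gi_power_mod cong_def)
  then show ?thesis using n by (simp add: quartic_char_def)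
qed

lemma mult_char_chi: "mult_char p chi"
  unfolding mult_char_def
proof (intro conjI allI)
  fix a b :: int
  show "chi (a mod int p) = chi a"
    by (simp add: quartic_char_def dlog_mod dvd_mod_iff)
  show "chi a = 0 \<longleftrightarrow> int p dvd a"
    using gi_power_cases[of "dlog p g a"] by (auto simp: quartic_char_def gint_eq_iff)
  show "chi (a * b) = chi a * chi b"
  proof (cases "int p dvd a \<or> int p dvd b")
    case True
    then show ?thesis by (auto simp: quartic_char_def)
  next
    case False
    then have "[int g ^ dlog p g a = a] (mod int p)" "[int g ^ dlog p g b = b] (mod int p)"
      using dlog[OF prime_p primroot] by auto
    then have "[int g ^ (dlog p g a + dlog p g b) = a * b] (mod int p)"
      by (simp add: power_add cong_mult)
    from chi_eq_gi_power[OF this] show ?thesis using False by (simp add: power_add quartic_char_def)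
  qed
qed

lemma chi_power_4:
  assumes "\<not> int p dvd n"
  shows "chi n ^ 4 = 1"
proof -
  have "chi n ^ 4 = (gi ^ 4) ^ dlog p g n"
    using assms by (simp only: quartic_char_def if_False power_mult[symmetric] mult.commute)
  then show ?thesis by (simp only: gi_power_4 power_one)
qed

lemma chi_cases: "\<not> int p dvd n \<Longrightarrow> \<exists>e. chi n = gi ^ e"
  by (auto simp: quartic_char_def)

lemma chi_g: "chi (int g) = gi"
  using chi_eq_gi_power[of 1 "int g"] by simp

lemma g_not_dvd: "\<not> int p dvd int g"
  using mult_char_eq_0_iff[OF mult_char_chi, of "int g"] chi_g by (auto simp: gint_eq_iff)

lemma chi_eq_1_imp_biquad_res:
  assumes "chi n = 1"
  shows "biquad_res n p"
proof -
  have n: "\<not> int p dvd n" using assms by (auto simp: quartic_char_def)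
  then have "4 dvd dlog p g n" using assms by (simp add: quartic_char_def gi_power_eq_1_iff)
  then obtain k where k: "dlog p g n = k * 4" by (auto elim: dvdE simp: mult.commute)
  have "[n = (int g ^ k) ^ 4] (mod int p)"
    using dlog[OF prime_p primroot n] k by (metis power_mult cong_sym)
  moreover have "\<not> int p dvd int g ^ k" using g_not_dvd prime_p
    by (meson prime_dvd_power prime_nat_int_transfer)
  ultimately show ?thesis unfolding biquad_res_def by blast
qed

section \<open>Relations between the Gauss sums of the powers of the quartic character\<close>

definition J :: gint where "J = jacobi_sum p chi chi"

abbreviation "G \<equiv> gpol p chi"
abbreviation "G2 \<equiv> gpol p (\<lambda>a. chi a ^ 2)"
abbreviation "G3 \<equiv> gpol p (\<lambda>a. chi a ^ 3)"
text \<open>Modulo \<open>cyc p\<close>, multiplication by \<open>N\<close> acts as multiplication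
  by \<open>p\<close> on the Gauss sums of nontrivial characters, see \<open>mult_N\<close>.\<close>

abbreviation "N \<equiv> [:of_nat p:] - gpol p (\<lambda>_. 1)"

lemma mult_char_chi2: "mult_char p (\<lambda>a. chi a ^ 2)"
  and mult_char_chi3: "mult_char p (\<lambda>a. chi a ^ 3)"
  by (rule mult_char_power[OF mult_char_chi]; simp)+

lemma sum_chi: "(\<Sum>a\<in>{0..<int p}. chi a) = 0"
  by (rule sum_mult_char_eq_0[OF prime_p mult_char_chi _ g_not_dvd]) (simp add: chi_g gint_eq_iff)

lemma sum_chi2: "(\<Sum>a\<in>{0..<int p}. chi a ^ 2) = 0"
  by (rule sum_mult_char_eq_0[OF prime_p mult_char_chi2 _ g_not_dvd]) (simp add: chi_g gi_power_2 gint_eq_iff)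

lemma sum_chi3: "(\<Sum>a\<in>{0..<int p}. chi a ^ 3) = 0"
  by (rule sum_mult_char_eq_0[OF prime_p mult_char_chi3 _ g_not_dvd]) (simp add: chi_g gi_power_3 gint_eq_iff)

lemma chi_power_add_4: "k > 0 \<Longrightarrow> chi a ^ (k + 4) = chi a ^ k"
  using chi_power_4[of a] by (cases "int p dvd a") (auto simp: quartic_char_def power_add)

lemma G_square: "ring_cong (cyc p) (G * G) (smult J G2)"
  using gpol_mult_char[OF prime_p mult_char_chi mult_char_chi] sum_chi2
  by (simp add: J_def power2_eq_square)

lemma gcnj_chi: "gcnj (chi a) = chi a ^ 3"
proof (cases "int p dvd a")
  case False
  then obtain e where e: "chi a = gi ^ e" using chi_cases by blast
  have "gcnj gi = gi ^ 3" by (simp add: gi_power_3 gint_eq_iff)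
  then show ?thesis by (simp add: e gcnj_power power_mult[symmetric] mult.commute)
qed (simp add: quartic_char_def)

lemma jacobi_sum_chi3: "jacobi_sum p (\<lambda>a. chi a ^ 3) (\<lambda>a. chi a ^ 3) = gcnj J"
  by (simp add: J_def conv_def gcnj_sum gcnj_mult gcnj_chi)

text \<open>The cube of \<open>chi\<close> is its complex conjugate, so its Jacobi sum is the
  conjugate of \<open>J\<close>; the square of the cube is \<open>chi ^ 2\<close> again.\<close>

lemma G3_square: "ring_cong (cyc p) (G3 * G3) (smult (gcnj J) G2)"
proof -
  have eq: "chi a ^ 3 * chi a ^ 3 = chi a ^ 2" for a
    using chi_power_add_4[of 2 a] by (simp add: power_add[symmetric])
  show ?thesis
    using gpol_mult_char[OF prime_p mult_char_chi3 mult_char_chi3] sum_chi2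
    unfolding eq jacobi_sum_chi3 by blast
qed

lemma chi_minus_1: "chi (-1) * chi (-1) = 1"
  by (rule mult_char_minus_1_square[OF mult_char_chi p_gt_1])

lemma G2_square: "ring_cong (cyc p) (G2 * G2) N"
proof -
  have "ring_cong (cyc p) (G2 * G2) (smult (chi (-1) ^ 2) N)"
  proof (rule gpol_mult_char_inverse[OF prime_p mult_char_chi2 mult_char_chi2 sum_chi2])
    show "chi a ^ 2 * chi a ^ 2 = 1" if "\<not> int p dvd a" for a
      using chi_power_4[OF that] by (simp add: power_add[symmetric])
  qed
  then show ?thesis using chi_minus_1 by (simp add: power2_eq_square)
qed

lemma G_G3: "ring_cong (cyc p) (G * G3) (smult (chi (-1)) N)"
proof -
  have "ring_cong (cyc p) (G * G3) (smult (chi (-1) ^ 3) N)"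
  proof (rule gpol_mult_char_inverse[OF prime_p mult_char_chi mult_char_chi3 sum_chi])
    show "chi a * chi a ^ 3 = 1" if "\<not> int p dvd a" for a
      using chi_power_4[OF that] by (simp add: power_Suc[symmetric] eval_nat_numeral)
  qed
  then show ?thesis using chi_minus_1 by (simp add: power3_eq_cube)
qed

lemma mult_N:
  assumes "(\<Sum>a\<in>{0..<int p}. F a) = 0"
  shows "ring_cong (cyc p) (gpol p F * N) (smult (of_nat p) (gpol p F))"
proof -
  have "ring_cong (cyc p) (gpol p F * [:of_nat p:] - gpol p F * gpol p (\<lambda>_. 1))
     (gpol p F * [:of_nat p:] - smult (\<Sum>a\<in>{0..<int p}. F a) (gpol p (\<lambda>_. 1)))"
    using p_gt_1 by (intro ring_cong_diff ring_cong_refl gpol_mult_const) auto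
  then show ?thesis by (simp add: assms right_diff_distrib)
qed

lemma ring_cong_smult: "ring_cong m x y \<Longrightarrow> ring_cong m (smult c x) (smult c y)"
  unfolding ring_cong_def by (metis dvd_smult smult_diff_right)

lemma cyc_coeff_N: "cyc_coeff p N = -1"
  using p_gt_1 cyc_coeff_gpol[of p "\<lambda>_. 1"] cyc_coeff_monom[of p "of_nat p" 0]
  by (simp add: cyc_coeff_diff monom_0)

text \<open>Compares the coefficients of \<open>x\<close> in \<open>(G * G) * (G3 * G3)\<close> and \<open>(G * G3) * (G * G3)\<close>.\<close>

lemma J_gcnj_J: "J * gcnj J = of_nat p"
proof -
  \<comment> \<open>The all-ones polynomial E satisfies E^2 = p E modulo \<open>cyc p\<close>, so (p
    - E)^2 = p (p - E).\<close>
  have NN: "ring_cong (cyc p) (N * N) (smult (of_nat p) N)"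
  proof -
    have "ring_cong (cyc p) (gpol p (\<lambda>_. 1) * gpol p (\<lambda>_. 1)) (smult (of_nat p) (gpol p (\<lambda>_. 1)))"
      using gpol_mult_const[of p "\<lambda>_. 1"] p_gt_1 by simp
    then have "ring_cong (cyc p) (([:of_nat p:] - smult 2 (gpol p (\<lambda>_. 1))) * [:of_nat p:] + gpol p (\<lambda>_. 1) * gpol p (\<lambda>_. 1))
      (([:of_nat p:] - smult 2 (gpol p (\<lambda>_. 1))) * [:of_nat p:] + smult (of_nat p) (gpol p (\<lambda>_. 1)))"
      by (intro ring_cong_add ring_cong_refl)
    moreover have "([:of_nat p:] - smult 2 P) * [:of_nat p:] + P * P = ([:of_nat p:] - P) * ([:of_nat p:] - P)"
      for P :: "gint poly"
    proof -
      have "smult 2 P = P + P" by (metis one_add_one smult_1_left smult_add_left)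
      then show ?thesis by (simp add: algebra_simps)
    qed
    moreover have "([:of_nat p:] - smult 2 P) * [:of_nat p:] + smult (of_nat p) P = smult (of_nat p) ([:of_nat p:] - P)"
      for P :: "gint poly"
    proof -
      have "smult 2 P = P + P" by (metis one_add_one smult_1_left smult_add_left)
      then show ?thesis by (simp add: algebra_simps smult_diff_right smult_add_right)
    qed
    ultimately show ?thesis by simp
  qed
  have "ring_cong (cyc p) ((G * G) * (G3 * G3)) (smult J G2 * smult (gcnj J) G2)"
    by (intro ring_cong_mult G_square G3_square)
  also have "smult J G2 * smult (gcnj J) G2 = smult (J * gcnj J) (G2 * G2)"
    by (simp add: mult.commute)
  also have "ring_cong (cyc p) \<dots> (smult (J * gcnj J) N)"
    by (intro ring_cong_smult G2_square)
  finally have 1: "ring_cong (cyc p) ((G * G) * (G3 * G3)) (smult (J * gcnj J) N)" .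
  have "ring_cong (cyc p) ((G * G3) * (G * G3)) (smult (chi (-1)) N * smult (chi (-1)) N)"
    by (intro ring_cong_mult G_G3)
  also have "smult (chi (-1)) N * smult (chi (-1)) N = N * N"
    by (simp only: mult_smult_left mult_smult_right smult_smult chi_minus_1 smult_1_left)
  also note NN
  finally have 2: "ring_cong (cyc p) ((G * G) * (G3 * G3)) (smult (of_nat p) N)"
    by (simp only: mult_ac)
  from cyc_coeff_ring_cong[OF ring_cong_trans[OF ring_cong_sym[OF 1] 2]] show ?thesis
    by (simp only: cyc_coeff_smult cyc_coeff_N) simp
qed

lemma gnorm_J: "gnorm J = int p"
proof -
  have "of_int (gnorm J) = (of_int (int p) :: gint)" using J_gcnj_J by (simp add: mult_gcnj)
  then show ?thesis by (simp only: of_int_eq_iff)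
qed

lemma J_nonzero: "J \<noteq> 0"
  using gnorm_J p_gt_1 by (auto simp: gnorm_def)

text \<open>Directly, the cube is \<open>J * J2\<close> times \<open>G3\<close>. Computing the
  fourth power of \<open>G\<close> both as \<open>G\<close> times its cube and as the square of its
  square, then comparing coefficients of x, gives \<open>J2 = J * chi (-1)\<close>.\<close>

lemma G_cube: "ring_cong (cyc p) (G * G * G) (smult (J * J * chi (-1)) G3)"
proof -
  define J2 where "J2 = jacobi_sum p (\<lambda>a. chi a ^ 2) chi"
  have eq: "chi a ^ 2 * chi a = chi a ^ 3" for a by (simp add: eval_nat_numeral)
  have "ring_cong (cyc p) (G2 * G) (smult J2 G3)"
    using gpol_mult_char[OF prime_p mult_char_chi2 mult_char_chi] sum_chi3
    by (simp add: eq J2_def)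
  then have "ring_cong (cyc p) (smult J (G2 * G)) (smult (J * J2) G3)"
    using ring_cong_smult by fastforce
  moreover have "ring_cong (cyc p) (G * G * G) (smult J (G2 * G))"
    using ring_cong_mult[OF G_square ring_cong_refl[of _ G]] by simp
  ultimately have cube: "ring_cong (cyc p) (G * G * G) (smult (J * J2) G3)"
    using ring_cong_trans by blast
  have "ring_cong (cyc p) (G * (G * G * G)) (G * smult (J * J2) G3)"
    by (intro ring_cong_mult ring_cong_refl cube)
  also have "G * smult (J * J2) G3 = smult (J * J2) (G * G3)" by simp
  also have "ring_cong (cyc p) \<dots> (smult (J * J2) (smult (chi (-1)) N))"
    by (intro ring_cong_smult G_G3)
  finally have 1: "ring_cong (cyc p) (G * (G * G * G)) (smult (J * J2 * chi (-1)) N)" by simp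
  have "ring_cong (cyc p) ((G * G) * (G * G)) (smult J G2 * smult J G2)"
    by (intro ring_cong_mult G_square)
  also have "smult J G2 * smult J G2 = smult (J * J) (G2 * G2)" by simp
  also have "ring_cong (cyc p) \<dots> (smult (J * J) N)"
    by (intro ring_cong_smult G2_square)
  finally have 2: "ring_cong (cyc p) (G * (G * G * G)) (smult (J * J) N)" by (simp only: mult_ac)
  from cyc_coeff_ring_cong[OF ring_cong_trans[OF ring_cong_sym[OF 1] 2]]
  have "J * J2 * chi (-1) = J * J" by (simp only: cyc_coeff_smult cyc_coeff_N) simp
  then have "J2 * chi (-1) = J" using J_nonzero by (simp add: mult.assoc)
  then have "J2 = J * chi (-1)" using chi_minus_1 by (metis mult.assoc mult.right_neutral)
  then show ?thesis using cube by (simp add: mult.assoc)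
qed

text \<open>The identity \<open>G ^ 4 = J ^ 2 * p\<close> is true only up to the all-ones polynomial
  modulo \<open>cyc p\<close>; the extra factor \<open>G\<close> annihilates that term.\<close>

lemma G_power_4: "ring_cong (cyc p) (G ^ 4 * G) (smult (J ^ 2 * of_nat p) G)"
proof -
  have "ring_cong (cyc p) ((G * G) * (G * G)) (smult J G2 * smult J G2)"
    by (intro ring_cong_mult G_square)
  also have "smult J G2 * smult J G2 = smult (J ^ 2) (G2 * G2)" by (simp add: power2_eq_square)
  also have "ring_cong (cyc p) \<dots> (smult (J ^ 2) N)"
    by (intro ring_cong_smult G2_square)
  finally have "ring_cong (cyc p) (G ^ 4) (smult (J ^ 2) N)" by (simp add: eval_nat_numeral mult_ac)
  then have "ring_cong (cyc p) (G * G ^ 4) (G * smult (J ^ 2) N)"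
    by (intro ring_cong_mult ring_cong_refl)
  also have "G * smult (J ^ 2) N = smult (J ^ 2) (G * N)" by simp
  also have "ring_cong (cyc p) \<dots> (smult (J ^ 2) (smult (of_nat p) G))"
    by (intro ring_cong_smult mult_N sum_chi)
  finally show ?thesis by (simp add: mult.commute)
qed

lemma G_power: "ring_cong (cyc p) (G ^ (4 * k + 1)) (smult ((J ^ 2 * of_nat p) ^ k) G)"
proof (induction k)
  case (Suc k)
  have "ring_cong (cyc p) (G ^ 4 * G ^ (4 * k + 1)) (G ^ 4 * smult ((J ^ 2 * of_nat p) ^ k) G)"
    by (intro ring_cong_mult ring_cong_refl Suc.IH)
  also have "G ^ 4 * smult ((J ^ 2 * of_nat p) ^ k) G = smult ((J ^ 2 * of_nat p) ^ k) (G ^ 4 * G)"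
    by simp
  also have "ring_cong (cyc p) \<dots> (smult ((J ^ 2 * of_nat p) ^ k) (smult (J ^ 2 * of_nat p) G))"
    by (intro ring_cong_smult G_power_4)
  finally have "ring_cong (cyc p) (G ^ 4 * G ^ (4 * k + 1)) (smult ((J ^ 2 * of_nat p) ^ Suc k) G)"
    by (simp add: mult_ac)
  moreover have "G ^ 4 * G ^ (4 * k + 1) = G ^ (4 * Suc k + 1)" by (simp only: power_add[symmetric]) simp
  ultimately show ?case by simp
qed simp

text \<open>By Frobenius, \<open>G ^ q\<close> is congruent modulo \<open>q\<close> to the sum of
  the \<open>q\<close>-th powers of its monomials. The exponent \<open>n * q\<close> is 1 modulo
  \<open>p\<close> only for \<open>n = r\<close>, the inverse of \<open>q\<close>.\<close>

lemma cyc_coeff_G_power_prime: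
  assumes "prime q" "q \<noteq> p" "(int q * r) mod int p = 1" "r \<in> {0..<int p}"
  shows "ring_cong (of_nat q) (cyc_coeff p (G ^ q)) (chi r ^ q)"
proof -
  have "ring_cong (of_nat q) (G ^ q) (\<Sum>n\<in>{0..<int p}. monom (chi n) (nat n) ^ q)"
    unfolding gpol_def by (rule ring_cong_sum_power_prime[OF assms(1)])
  then have "ring_cong (of_nat q) (cyc_coeff p (G ^ q)) (cyc_coeff p (\<Sum>n\<in>{0..<int p}. monom (chi n) (nat n) ^ q))"
    by (rule cyc_coeff_ring_cong_of_nat)
  also have "cyc_coeff p (\<Sum>n\<in>{0..<int p}. monom (chi n) (nat n) ^ q) =
      (\<Sum>n\<in>{0..<int p}. if n = r then chi n ^ q else 0)"
    unfolding cyc_coeff_sum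
  proof (rule sum.cong[OF refl])
    fix n assume n: "n \<in> {0..<int p}"
    have "(nat n * q) mod p = 1 \<longleftrightarrow> (int q * n) mod int p = 1"
    proof -
      have "int ((nat n * q) mod p) = (int q * n) mod int p"
        using n by (simp add: zmod_int mult.commute)
      then show ?thesis by (metis of_nat_1 of_nat_eq_iff)
    qed
    also have "\<dots> \<longleftrightarrow> n = r"
    proof
      assume "(int q * n) mod int p = 1"
      then have "int p dvd int q * (n - r)" using assms(3) by (metis mod_eq_dvd_iff right_diff_distrib)
      moreover have "\<not> int p dvd int q"
        using assms(1,2) prime_p by (metis of_nat_dvd_iff primes_dvd_imp_eq)
      ultimately have "int p dvd n - r" using prime_p by (simp add: prime_dvd_mult_iff)
      then have "n mod int p = r mod int p" by (simp add: mod_eq_dvd_iff)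
      then show "n = r" using n assms(4) by simp
    qed (use assms(3) in simp)
    finally show "cyc_coeff p (monom (chi n) (nat n) ^ q) = (if n = r then chi n ^ q else 0)"
      by (simp add: monom_power cyc_coeff_monom)
  qed
  also have "\<dots> = chi r ^ q" using assms(4) by simp
  finally show ?thesis .
qed

end

subsection \<open>Prime divisors of a quartic form\<close>

text \<open>The imaginary part of \<open>(a + b i) (x + i)\<^sup>4\<close>.\<close>

definition quartic_form :: "int \<Rightarrow> int \<Rightarrow> int \<Rightarrow> int" where
  "quartic_form a b x = b * (x ^ 4 - 6 * x ^ 2 + 1) + a * (4 * x ^ 3 - 4 * x)"

lemma quartic_form_eq: "quartic_form (gre z) (gim z) x = gim (z * (of_int x + gi) ^ 4)"
  by (simp add: quartic_form_def eval_nat_numeral algebra_simps)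

text \<open>Modulo \<open>x\<^sup>2 + 1\<close> the form reduces to \<open>8 * (b - a * x)\<close>,
  so \<open>b\<close> is \<open>a * x\<close> and \<open>b\<^sup>2\<close> is
  \<open>- a\<^sup>2\<close> modulo \<open>q\<close>. When the norm is the prime \<open>p\<close>,
  only \<open>q = p\<close> can do this; for all other \<open>q\<close> the element
  \<open>x + i\<close> is invertible modulo \<open>q\<close>.\<close>

lemma dvd_quartic_form_imp_dvd_norm:
  assumes "prime q" "odd q" "int q dvd quartic_form a b x" "int q dvd x\<^sup>2 + 1"
  shows "int q dvd a\<^sup>2 + b\<^sup>2"
proof -
  have prq: "prime (int q)" using assms(1) by simp
  \<comment> \<open>Division of the form by \<open>x\<^sup>2 + 1\<close> with remainder, as
    polynomials in \<open>x\<close>.\<close>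
  have "quartic_form a b x = (x\<^sup>2 + 1) * (b * (x ^ 2 - 7) + 4 * a * x) + 8 * (b - a * x)"
    by (simp add: quartic_form_def eval_nat_numeral algebra_simps)
  then have "int q dvd 8 * (b - a * x)" using assms(3,4) by (simp add: dvd_add_right_iff)
  moreover have "coprime (int q) 2" using assms(1,2) by (simp add: coprime_commute)
  then have "coprime (int q) 8" using coprime_power_right_iff[of "int q" 2 3] by simp
  ultimately have "int q dvd b - a * x" using coprime_dvd_mult_right_iff by blast
  then have "int q dvd (b - a * x) * (b + a * x) + a ^ 2 * (x\<^sup>2 + 1)" using assms(4) by simp
  also have "(b - a * x) * (b + a * x) + a ^ 2 * (x\<^sup>2 + 1) = a\<^sup>2 + b\<^sup>2"
    by (simp add: power2_eq_square algebra_simps)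
  finally show ?thesis .
qed

text \<open>Frobenius fixes \<open>x\<close> by Fermat; \<open>gi ^ q\<close> is \<open>gi\<close>
  or \<open>- gi\<close> according to \<open>q\<close> modulo 4, so the result is
  \<open>x + i\<close> or its conjugate.\<close>

lemma ring_cong_power_prime_plus_gi:
  assumes "prime q" "odd q"
  shows "ring_cong (of_nat q) ((of_int x + gi) ^ q) (of_int x + gi ^ q)"
proof -
  have "ring_cong (of_nat q) ((of_int x + gi) ^ q) (of_int x ^ q + gi ^ q)"
    by (rule ring_cong_add_power_prime[OF assms(1)])
  moreover have "ring_cong (of_nat q) (of_int x ^ q) (of_int x :: gint)"
  proof (cases "int q dvd x")
    case True
    then have "int q dvd x ^ q - x"
      using prime_gt_0_nat[OF assms(1)] by (intro dvd_diff) (auto simp: dvd_power_iff intro: dvd_power_le dvd_trans[OF _ dvd_power])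
    then have "of_nat q dvd (of_int (x ^ q - x) :: gint)"
      unfolding of_nat_dvd_gint_iff gint_of_int by simp
    then show ?thesis by (simp add: ring_cong_def)
  next
    case False
    have "q = Suc (q - 1)" using prime_gt_0_nat[OF assms(1)] by simp
    then have "of_int x ^ q = (of_int x ^ (q - 1) * of_int x :: gint)" by (metis power_Suc2)
    then show ?thesis
      using ring_cong_mult[OF ring_cong_power_prime_minus_1[OF assms(1) False] ring_cong_refl[of _ "of_int x"]]
      by simp
  qed
  ultimately show ?thesis using ring_cong_trans ring_cong_add ring_cong_refl by blast
qed

lemma ring_cong_cancel:
  assumes "ring_cong (of_nat q) (of_int n * x) (of_int n * y :: gint)" "prime q" "\<not> int q dvd n"
  shows "ring_cong (of_nat q) x y"
proof -
  have "int q dvd n * gre (x - y)" "int q dvd n * gim (x - y)"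
    using assms(1) by (auto simp: ring_cong_def of_nat_dvd_gint_iff right_diff_distrib)
  then show ?thesis using assms(2,3)
    by (auto simp: ring_cong_def of_nat_dvd_gint_iff prime_dvd_mult_iff)
qed

section \<open>Reciprocity for the prime divisors of the form\<close>

context quartic_setup
begin

text \<open>With \<open>u = x + i\<close> of norm \<open>n\<close>, the product
  \<open>J * u ^ 4\<close> is congruent to an integer \<open>m\<close> modulo \<open>q\<close>, and
  taking norms gives \<open>m ^ 2 = p * n ^ 4\<close> modulo \<open>q\<close>. The coefficient of x
  in \<open>G ^ q\<close> is computed twice: through powers of \<open>C\<close> and through
  Frobenius as a power of \<open>chi r\<close>. Powers of \<open>u\<close> and \<open>n\<close> turn
  the powers of \<open>C\<close> into powers of \<open>m\<close>, which Fermat evaluates.\<close>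

theorem biquad_res_qstar:
  assumes q: "prime q" "odd q" "q \<noteq> p" and dvd: "int q dvd quartic_form (gre J) (gim J) x"
  shows "biquad_res (qstar q) p"
proof -
  let ?c = "ring_cong (of_nat q :: gint)"
  have q3: "q \<ge> 3" using q prime_ge_2_nat[of q] by (cases "q = 2") auto
  have qp: "\<not> int q dvd int p" using q prime_p by (metis of_nat_dvd_iff primes_dvd_imp_eq)
  have pq: "\<not> int p dvd int q" using q prime_p by (metis of_nat_dvd_iff primes_dvd_imp_eq)
  define u where "u = of_int x + gi"
  define m where "m = gre (J * u ^ 4)"
  define n where "n = x ^ 2 + 1"
  have un: "u * gcnj u = of_int n" by (simp add: u_def n_def gint_eq_iff power2_eq_square)
  have 1: "?c (J * u ^ 4) (of_int m)"
    using dvd unfolding quartic_form_eq ring_cong_def of_nat_dvd_gint_iff by (simp add: m_def u_def)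
  then have 2: "?c (gcnj J * gcnj u ^ 4) (of_int m)"
  proof -
    have "gcnj (J * u ^ 4) - of_int m = gcnj (J * u ^ 4 - of_int m)" by (simp add: gcnj_diff)
    then show ?thesis using 1
      by (simp add: ring_cong_def of_nat_dvd_gint_iff gcnj_mult gcnj_power del: gint_sel(11,12))
  qed
  have m2: "?c (of_nat p * of_int n ^ 4) (of_int m ^ 2)"
  proof -
    have "?c ((J * u ^ 4) * (gcnj J * gcnj u ^ 4)) (of_int m * of_int m)"
      by (intro ring_cong_mult 1 2)
    moreover have "(J * u ^ 4) * (gcnj J * gcnj u ^ 4) = (J * gcnj J) * (u * gcnj u) ^ 4"
      by (simp only: power_mult_distrib mult_ac)
    ultimately show ?thesis by (simp add: un J_gcnj_J power2_eq_square)
  qed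
  have qm: "int q dvd int p * n ^ 4 - m ^ 2"
  proof -
    have "of_nat q dvd (of_int (int p * n ^ 4 - m ^ 2) :: gint)" using m2 by (simp add: ring_cong_def)
    then show ?thesis unfolding of_nat_dvd_gint_iff gint_of_int by simp
  qed
  have prq: "prime (int q)" using q(1) by simp
  have n: "\<not> int q dvd n"
  proof
    assume *: "int q dvd n"
    have "int q dvd (gre J)\<^sup>2 + (gim J)\<^sup>2" by (rule dvd_quartic_form_imp_dvd_norm[OF q(1,2) dvd]) (use * in \<open>simp add: n_def\<close>)
    then show False using qp gnorm_J by (simp add: gnorm_def)
  qed
  have m: "\<not> int q dvd m"
  proof
    assume "int q dvd m"
    then have "int q dvd int p * n ^ 4" using qm by (simp add: dvd_diff_left_iff power2_eq_square dvd_diff_right_iff)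
    then show False using prq qp n by (meson prime_dvd_mult_iff prime_dvd_power)
  qed
  \<comment> \<open>The inverse of \<open>q\<close> modulo \<open>p\<close>; it is the only residue
    whose monomial contributes to the coefficient of x after Frobenius.\<close>
  define r where "r = (SOME r. r \<in> {0..<int p} \<and> (int q * r) mod int p = 1)"
  have r: "r \<in> {0..<int p}" "(int q * r) mod int p = 1"
  proof -
    have "1 \<in> (\<lambda>b. (int q * b) mod int p) ` {0..<int p}"
      using bij_betw_mult_mod[OF prime_p pq] p_gt_1 by (auto simp: bij_betw_def)
    then have "\<exists>r. r \<in> {0..<int p} \<and> (int q * r) mod int p = 1" by auto
    from someI_ex[OF this] show "r \<in> {0..<int p}" "(int q * r) mod int p = 1" by (auto simp: r_def)
  qed
  have chi_qr: "chi (int q) * chi r = 1"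
  proof -
    have "chi (int q * r) = chi 1"
      by (rule mult_char_cong[OF mult_char_chi]) (use r(2) p_gt_1 in simp)
    then show ?thesis using mult_char_mult[OF mult_char_chi] mult_char_1[OF mult_char_chi p_gt_1] by simp
  qed
  have r_nz: "\<not> int p dvd r" using chi_qr by (auto simp: quartic_char_def)
  note coeff = cyc_coeff_G_power_prime[OF q(1,3) r(2,1)]
  have cG: "cyc_coeff p G = 1" "cyc_coeff p G3 = 1"
    using cyc_coeff_gpol[OF p_gt_1] mult_char_1[OF mult_char_chi p_gt_1] by auto
  define C where "C = J ^ 2 * of_nat p"
  \<comment> \<open>The case \<open>k = 1\<close> says that \<open>(J * u ^ 4) ^ 2\<close> times
    \<open>p * n ^ 4\<close> is \<open>m ^ 4\<close>: the first factor is the square of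
    \<open>m\<close>, the second is \<open>m ^ 2\<close> by \<open>m2\<close>.\<close>
  have C_u: "?c (C ^ k * (u ^ 2) ^ (4 * k) * of_int n ^ (4 * k)) (of_int m ^ (4 * k))" for k
  proof -
    have "?c ((J * u ^ 4) ^ 2 * (of_nat p * of_int n ^ 4)) (of_int m ^ 2 * of_int m ^ 2)"
      by (intro ring_cong_mult ring_cong_power 1 m2)
    then have "?c (((J * u ^ 4) ^ 2 * (of_nat p * of_int n ^ 4)) ^ k) ((of_int m ^ 2 * of_int m ^ 2) ^ k)"
      by (rule ring_cong_power)
    moreover have "((J * u ^ 4) ^ 2 * (of_nat p * of_int n ^ 4)) ^ k = C ^ k * (u ^ 2) ^ (4 * k) * of_int n ^ (4 * k)"
      by (simp add: C_def power_mult_distrib power_mult[symmetric] mult_ac)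
    moreover have "(of_int m ^ 2 * of_int m ^ 2) ^ k = (of_int m ^ (4 * k) :: gint)"
      by (simp add: power_add[symmetric] power_mult)
    ultimately show ?thesis by simp
  qed
  have chi_r: "\<exists>e. chi y = gi ^ e" if "\<not> int p dvd y" for y using chi_cases[OF that] .
  have "q mod 4 = 1 \<or> q mod 4 = 3" using q(2) by presburger
  then show ?thesis
  proof
    assume "q mod 4 = 1"
    define k where "k = q div 4"
    have k: "q = 4 * k + 1" using \<open>q mod 4 = 1\<close> by (simp add: k_def) presburger
    have "cyc_coeff p (G ^ q) = C ^ k"
      using cyc_coeff_ring_cong[OF G_power[of k]] cG by (simp add: k cyc_coeff_smult C_def)
    moreover have "gi ^ q = gi" by (subst gi_power_mod) (simp add: \<open>q mod 4 = 1\<close>)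
    moreover have "chi r ^ q = chi r"
      using chi_power_4[OF r_nz] by (simp add: k power_mult)
    ultimately have Cr: "?c (C ^ k) (chi r)" using coeff by simp
    have "?c (u ^ q) u" using ring_cong_power_prime_plus_gi[OF q(1,2), of x] \<open>gi ^ q = gi\<close> by (simp add: u_def)
    \<comment> \<open>The factor \<open>u\<close> is cancelled by multiplying with its conjugate,
      which turns it into the integer \<open>n\<close>, prime to \<open>q\<close>.\<close>
    then have "?c (gcnj u * u ^ q) (gcnj u * u)" by (intro ring_cong_mult ring_cong_refl)
    moreover have "gcnj u * u ^ q = of_int n * u ^ (4 * k)" using un by (simp add: k mult_ac)
    moreover have "gcnj u * u = of_int n * 1" using un by (simp add: mult_ac)
    ultimately have u: "?c (u ^ (4 * k)) 1" using ring_cong_cancel[OF _ q(1) n] by simp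
    have n1: "?c (of_int n ^ (4 * k)) 1" using ring_cong_power_prime_minus_1[OF q(1) n] by (simp add: k)
    have m1: "?c (of_int m ^ (4 * k)) 1" using ring_cong_power_prime_minus_1[OF q(1) m] by (simp add: k)
    have u2: "?c ((u ^ 2) ^ (4 * k)) 1" using ring_cong_power[OF u, of 2] by (simp add: power_mult[symmetric] mult.commute)
    have "?c (C ^ k * 1 * 1) (C ^ k * (u ^ 2) ^ (4 * k) * of_int n ^ (4 * k))"
      by (intro ring_cong_mult ring_cong_refl ring_cong_sym[OF u2] ring_cong_sym[OF n1])
    then have "?c (C ^ k) 1" using ring_cong_trans C_u[of k] m1 by (metis mult.right_neutral)
    then have "?c (chi r) 1" using Cr ring_cong_trans ring_cong_sym by blast
    then have "chi r = 1" using gi_power_cong_1[OF _ q3] chi_r[OF r_nz] by (auto simp: ring_cong_def)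
    then have "chi (int q) = 1" using chi_qr by simp
    moreover have "even ((q - 1) div 2)" by (simp add: k)
    then have "qstar q = int q" by (simp add: qstar_def)
    ultimately show ?thesis using chi_eq_1_imp_biquad_res by simp
  next
    assume "q mod 4 = 3"
    define k where "k = q div 4"
    have k: "q = 4 * k + 3" using \<open>q mod 4 = 3\<close> by (simp add: k_def) presburger
    \<comment> \<open>Here \<open>q = (4 * k + 1) + 2\<close>, so the cube of \<open>G\<close>
      remains and \<open>G_cube\<close> brings in \<open>chi (-1)\<close>, the source of the sign in
      \<open>qstar q\<close>.\<close>
    have Gq: "ring_cong (cyc p) (G ^ (4 * k + 1) * (G * G)) (smult (C ^ k) (G * G * G))"
      using ring_cong_mult[OF G_power[of k] ring_cong_refl[of _ "G * G"]] by (simp add: C_def mult_ac)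
    also have "ring_cong (cyc p) (smult (C ^ k) (G * G * G)) (smult (C ^ k) (smult (J * J * chi (-1)) G3))"
      by (intro ring_cong_smult G_cube)
    finally have "cyc_coeff p (G ^ (4 * k + 1) * (G * G)) = C ^ k * (J * J * chi (-1))"
      using cG by (metis cyc_coeff_ring_cong cyc_coeff_smult mult.right_neutral)
    moreover have "G ^ (4 * k + 1) * (G * G) = G ^ q" by (simp add: k power_add eval_nat_numeral mult_ac)
    ultimately have "cyc_coeff p (G ^ q) = C ^ k * J ^ 2 * chi (-1)" by (simp add: power2_eq_square mult_ac)
    moreover have "chi r ^ q = chi r ^ 3"
      using chi_power_4[OF r_nz] by (simp add: k power_mult power_add)
    moreover have "chi r ^ 3 = chi (int q)"
    proof -
      have "chi r ^ 3 = chi (int q) * chi r * chi r ^ 3" using chi_qr by simp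
      also have "\<dots> = chi (int q) * chi r ^ 4" by (simp add: eval_nat_numeral mult_ac)
      finally show ?thesis using chi_power_4[OF r_nz] by simp
    qed
    ultimately have "?c (C ^ k * J ^ 2 * chi (-1)) (chi (int q))" using coeff by simp
    \<comment> \<open>The missing factor \<open>p\<close> completes \<open>C ^ k * J ^ 2\<close> to
      \<open>C ^ (k + 1)\<close>, and \<open>chi (-1)\<close> moves to the side of
      \<open>chi (int q)\<close>.\<close>
    then have "?c (C ^ k * J ^ 2 * chi (-1) * (chi (-1) * of_nat p)) (chi (int q) * (chi (-1) * of_nat p))"
      by (intro ring_cong_mult ring_cong_refl)
    moreover have "C ^ k * J ^ 2 * chi (-1) * (chi (-1) * of_nat p) = C ^ (k + 1)"
    proof -
      have "C ^ k * J ^ 2 * chi (-1) * (chi (-1) * of_nat p) = C ^ k * (J ^ 2 * of_nat p) * (chi (-1) * chi (-1))"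
        by (simp only: mult_ac)
      then show ?thesis by (simp only: chi_minus_1 C_def[symmetric] power_add power_one_right mult_1_right)
    qed
    moreover have "chi (int q) * chi (-1) = chi (qstar q)"
    proof -
      have "odd ((q - 1) div 2)" by (simp add: k)
      then have "qstar q = int q * (-1)" by (simp add: qstar_def)
      then show ?thesis by (simp only: mult_char_mult[OF mult_char_chi])
    qed
    ultimately have CC: "?c (C ^ (k + 1)) (chi (qstar q) * of_nat p)"
      by (simp only: mult.assoc[of "chi (int q)", symmetric])
    have "gi ^ q = - gi" by (subst gi_power_mod) (simp add: \<open>q mod 4 = 3\<close> gi_power_3)
    then have "?c (u ^ q) (gcnj u)"
    proof -
      have "gcnj u = of_int x + - gi" by (simp add: u_def gint_eq_iff)
      then show ?thesis using ring_cong_power_prime_plus_gi[OF q(1,2), of x] \<open>gi ^ q = - gi\<close> by (simp only: u_def)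
    qed
    then have "?c (u ^ q * u) (gcnj u * u)" by (intro ring_cong_mult ring_cong_refl)
    then have u: "?c (u ^ (4 * (k + 1))) (of_int n)" using un by (simp add: k mult_ac power_add eval_nat_numeral)
    \<comment> \<open>The exponent is \<open>q + 1\<close>, so Fermat leaves a square instead of
      1.\<close>
    have q1: "4 * (k + 1) = (q - 1) + 2" by (simp add: k)
    have pw: "?c (of_int y ^ (4 * (k + 1))) (of_int y ^ 2)" if "\<not> int q dvd y" for y
      using ring_cong_mult[OF ring_cong_power_prime_minus_1[OF q(1) that] ring_cong_refl[of _ "of_int y ^ 2"]]
      unfolding q1 by (simp only: power_add mult_1_left)
    \<comment> \<open>Both sides will be compared with \<open>m ^ 2\<close>, that is with
      \<open>p * n ^ 4\<close>; this integer is prime to \<open>q\<close> and cancels, leaving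
      \<open>chi (qstar q)\<close> congruent to 1.\<close>
    have "?c (chi (qstar q) * of_nat p * of_int n ^ 2 * of_int n ^ 2)
        (C ^ (k + 1) * (u ^ 2) ^ (4 * (k + 1)) * of_int n ^ (4 * (k + 1)))"
    proof (intro ring_cong_mult ring_cong_sym[OF CC] ring_cong_sym[OF pw[OF n]])
      have "?c ((u ^ (4 * (k + 1))) ^ 2) (of_int n ^ 2)" by (rule ring_cong_power[OF u])
      then show "?c (of_int n ^ 2) ((u ^ 2) ^ (4 * (k + 1)))"
        by (metis ring_cong_sym power_mult mult.commute)
    qed
    also have "?c \<dots> (of_int m ^ (4 * (k + 1)))" by (rule C_u)
    also have "?c \<dots> (of_int m ^ 2)" by (rule pw[OF m])
    also have "?c \<dots> (of_nat p * of_int n ^ 4)" by (rule ring_cong_sym[OF m2])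
    finally have "?c (of_int (int p * n ^ 4) * chi (qstar q)) (of_int (int p * n ^ 4) * 1)"
      by (simp add: eval_nat_numeral mult_ac)
    moreover have "\<not> int q dvd int p * n ^ 4"
      using prq qp n by (meson prime_dvd_mult_iff prime_dvd_power)
    ultimately have "?c (chi (qstar q)) 1" using ring_cong_cancel[OF _ q(1)] by blast
    moreover have "\<not> int p dvd qstar q"
    proof -
      have "qstar q = int q \<or> qstar q = - int q"
        by (cases "even ((q - 1) div 2)") (auto simp: qstar_def)
      then show ?thesis using pq by auto
    qed
    ultimately have "chi (qstar q) = 1" unfolding ring_cong_def by (metis chi_r gi_power_cong_1 q3)
    then show ?thesis by (rule chi_eq_1_imp_biquad_res)
  qed
qed

end

theorem ex_quartic_form_reciprocity:
  assumes "prime p" "[p = 1] (mod 4)"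
  obtains a b where "a\<^sup>2 + b\<^sup>2 = int p"
    "\<And>q x. prime q \<Longrightarrow> odd q \<Longrightarrow> q \<noteq> p \<Longrightarrow> int q dvd quartic_form a b x \<Longrightarrow> biquad_res (qstar q) p"
proof -
  obtain g where "residue_primroot p g" using prime_primitive_root_exists[of p] assms(1) prime_gt_1_nat by blast
  then interpret quartic_setup p g using assms by unfold_locales
  show thesis
    by (rule that[of "gre J" "gim J"]) (use gnorm_J biquad_res_qstar in \<open>auto simp: gnorm_def\<close>)
qed

subsection \<open>Counting the solutions of \<open>f(x) \<equiv> 0\<close> modulo a prime power\<close>

text \<open>With \<open>u = (x + i)\<^sup>4\<close> and \<open>v = (y + i)\<^sup>4\<close>, the number below is the imaginary part of
  \<open>u * cnj v = ((x * y + 1) + (y - x) i)\<^sup>4\<close>. It is also the determinant of the linear forms in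
  \<open>(a, b)\<close> that \<open>quartic_form a b x\<close> and \<open>quartic_form a b y\<close> are.\<close>

definition quartic_det :: "int \<Rightarrow> int \<Rightarrow> int" where
  "quartic_det x y = 4 * ((x * y + 1) * (y - x) * ((x * y + 1 - (y - x)) * (x * y + 1 + (y - x))))"

text \<open>Cramer's rule, eliminating \<open>b\<close>; the companion identity eliminates
  \<open>a\<close>.\<close>

lemma quartic_det_left:
  "a * quartic_det x y =
     quartic_form a b x * (y ^ 4 - 6 * y ^ 2 + 1) - quartic_form a b y * (x ^ 4 - 6 * x ^ 2 + 1)"
  unfolding quartic_det_def quartic_form_def by (simp add: eval_nat_numeral algebra_simps)

lemma quartic_det_right:
  "b * quartic_det x y =
     quartic_form a b y * (4 * x ^ 3 - 4 * x) - quartic_form a b x * (4 * y ^ 3 - 4 * y)"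
  unfolding quartic_det_def quartic_form_def by (simp add: eval_nat_numeral algebra_simps)

text \<open>The square of a common divisor divides the prime \<open>p\<close>, so the divisor is a
  unit.\<close>

lemma coprime_of_prime_norm:
  assumes "prime p" "a\<^sup>2 + b\<^sup>2 = int p"
  shows "coprime a (b::int)"
proof (rule coprimeI)
  fix d assume "d dvd a" "d dvd b"
  then have "d\<^sup>2 dvd int p" unfolding assms(2)[symmetric] by (intro dvd_add dvd_power_same)
  then obtain e where "int p = d * (d * e)" by (metis dvdE mult.assoc power2_eq_square)
  moreover have "irreducible (int p)"
    using assms(1) by (simp add: prime_elem_imp_irreducible)
  ultimately have "is_unit d \<or> is_unit (d * e)" using irreducibleD by blast
  then show "is_unit d" using dvd_mult_left by blast
qed

lemma dvd_quartic_det: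
  assumes "coprime a b" "m dvd quartic_form a b x" "m dvd quartic_form a b y"
  shows "m dvd quartic_det x y"
proof -
  have "m dvd a * quartic_det x y" unfolding quartic_det_left[of a x y b] using assms by simp
  moreover have "m dvd b * quartic_det x y" unfolding quartic_det_right[of b x y a] using assms by simp
  ultimately have "m dvd gcd (a * quartic_det x y) (b * quartic_det x y)" by simp
  also have "gcd (a * quartic_det x y) (b * quartic_det x y) dvd quartic_det x y"
    using assms(1) by (simp add: gcd_mult_right coprime_iff_gcd_eq_1[symmetric] gcd.commute abs_mult)
  finally show ?thesis .
qed

lemma prime_power_dvd_mult:
  fixes q x y :: "'a::factorial_semiring_gcd"
  assumes "prime q" "q ^ k dvd x * y" "\<not> (q dvd x \<and> q dvd y)"
  shows "q ^ k dvd x \<or> q ^ k dvd y"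
proof (cases "q dvd x")
  case True
  then have "coprime (q ^ k) y" using assms by (simp add: prime_imp_coprime)
  then show ?thesis using assms(2) by (simp add: coprime_dvd_mult_left_iff)
next
  case False
  then have "coprime (q ^ k) x" using assms by (simp add: prime_imp_coprime)
  then show ?thesis using assms(2) by (simp add: coprime_dvd_mult_right_iff)
qed

text \<open>With P = \<open>x * y + 1\<close> and Q = \<open>y - x\<close> the determinant is 4 P Q
  (P - Q) (P + Q). If the odd prime \<open>q\<close> does not divide both P and Q, at most one of
  the four factors is divisible by \<open>q\<close>, and it takes the whole power. For
  \<open>k = 1\<close> primality suffices.\<close>

lemma prime_power_dvd_quartic_det:
  assumes q: "prime q" "odd q" and m: "int q ^ k dvd quartic_det x y"
    and k: "k = 1 \<or> \<not> (int q dvd x * y + 1 \<and> int q dvd y - x)"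
  shows "int q ^ k dvd x * y + 1 \<or> int q ^ k dvd y - x \<or>
         int q ^ k dvd x * y + 1 - (y - x) \<or> int q ^ k dvd x * y + 1 + (y - x)"
proof -
  define P Q where "P = x * y + 1" and "Q = y - x"
  have prq: "prime (int q)" using q by simp
  have c2: "coprime (int q) 2" using q by (simp add: coprime_commute)
  then have c4: "coprime (int q ^ k) 4"
    using coprime_mult_right_iff[of "int q ^ k" 2 2] by simp
  then have *: "int q ^ k dvd (P * Q) * ((P - Q) * (P + Q))"
    using m by (simp add: quartic_det_def P_def Q_def coprime_dvd_mult_right_iff)
  show ?thesis
  proof (cases "k = 1")
    case True
    then show ?thesis using * prq by (auto simp: prime_dvd_mult_iff P_def Q_def)
  next
    case False
    then have PQ: "\<not> (int q dvd P \<and> int q dvd Q)" using k by (simp add: P_def Q_def)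
    have PQ2: "\<not> (int q dvd (P * Q) \<and> int q dvd (P - Q) * (P + Q))"
      using PQ prq by (auto simp: prime_dvd_mult_iff dvd_diff_right_iff dvd_diff_left_iff dvd_add_right_iff dvd_add_left_iff)
    have PQ3: "\<not> (int q dvd P - Q \<and> int q dvd P + Q)"
    proof
      assume "int q dvd P - Q \<and> int q dvd P + Q"
      then have "int q dvd (P - Q) + (P + Q)" "int q dvd (P + Q) - (P - Q)" by (blast intro: dvd_add dvd_diff)+
      then have "int q dvd 2 * P" "int q dvd 2 * Q" by simp_all
      then show False using PQ c2 by (simp add: coprime_dvd_mult_right_iff)
    qed
    from prime_power_dvd_mult[OF prq * PQ2] show ?thesis
      using prime_power_dvd_mult[OF prq _ PQ] prime_power_dvd_mult[OF prq _ PQ3]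
      unfolding P_def Q_def by blast
  qed
qed

text \<open>If \<open>q\<close> divided \<open>c\<close>, it would also divide \<open>d\<close>;
  hence \<open>c\<close> is invertible modulo \<open>q ^ k\<close>.\<close>

lemma prime_power_dvd_linear_unique:
  fixes c d y y' :: int
  assumes "prime q" "k > 0" "int q ^ k dvd c * y + d" "int q ^ k dvd c * y' + d"
    "\<not> (int q dvd c \<and> int q dvd d)"
  shows "int q ^ k dvd y - y'"
proof -
  have "int q dvd c * y + d" using assms(2,3) dvd_trans dvd_power by blast
  then have "\<not> int q dvd c" using assms(5) by (auto simp: dvd_add_right_iff)
  then have "coprime (int q ^ k) c" using assms(1) by (simp add: prime_imp_coprime)
  moreover have "int q ^ k dvd (c * y + d) - (c * y' + d)" using assms(3,4) by (rule dvd_diff)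
  then have "int q ^ k dvd c * (y - y')" by (simp add: algebra_simps)
  ultimately show ?thesis by (simp add: coprime_dvd_mult_right_iff)
qed

lemma card_le_of_dvd_diff:
  assumes "A \<subseteq> {T<..2 * T}" "m > 0" "\<And>s t. s \<in> A \<Longrightarrow> t \<in> A \<Longrightarrow> int m dvd int s - int t"
  shows "card A \<le> T div m + 1"
proof (cases "A = {}")
  case False
  have fin: "finite A" using assms(1) finite_subset by blast
  define s where "s = Min A"
  have s: "s \<in> A" "\<And>t. t \<in> A \<Longrightarrow> s \<le> t" using False fin by (auto simp: s_def)
  have dvd: "m dvd t - s" if "t \<in> A" for t
    using assms(3)[OF that s(1)] s(2)[OF that] by (metis of_nat_diff of_nat_dvd_iff)
  have "inj_on (\<lambda>t. (t - s) div m) A"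
  proof (rule inj_onI)
    fix t t' assume t: "t \<in> A" "t' \<in> A" "(t - s) div m = (t' - s) div m"
    then have "t - s = t' - s" using dvd by (metis dvd_div_mult_self)
    then show "t = t'" using s(2) t by (metis le_add_diff_inverse)
  qed
  moreover have "(\<lambda>t. (t - s) div m) ` A \<subseteq> {..T div m}"
  proof (rule image_subsetI)
    fix t assume "t \<in> A"
    then have "t \<le> 2 * T" "s > T" using assms(1) s(1) by auto
    then show "(t - s) div m \<in> {..T div m}" by (simp add: div_le_mono)
  qed
  ultimately have "card A \<le> card {..T div m}" by (metis card_inj_on_le finite_atMost)
  then show ?thesis by simp
qed simp

lemma card_Un4_le:
  assumes "card A \<le> n" "card B \<le> n" "card C \<le> n" "card D \<le> n"
  shows "card (A \<union> B \<union> C \<union> D) \<le> 4 * n"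
  using card_Un_le[of "A \<union> B \<union> C" D] card_Un_le[of "A \<union> B" C] card_Un_le[of A B] assms by linarith

text \<open>One root \<open>x\<close> is fixed. Any other root \<open>y\<close> makes
  \<open>q ^ k\<close> divide one of four factors of \<open>quartic_det x y\<close>, each linear in
  \<open>y\<close>, so the roots lie in at most four residue classes. The step 32 is invertible
  because \<open>q\<close> is odd.\<close>

lemma card_quartic_form_roots:
  assumes p: "prime p" "a\<^sup>2 + b\<^sup>2 = int p" and q: "prime q" "odd q" and k: "k > 0" "k = 1 \<or> q \<noteq> p"
  shows "card {t \<in> {T<..2 * T}. int q ^ k dvd quartic_form a b (r + 32 * int t)} \<le> 4 * (T div q ^ k + 1)"
proof (cases "{t \<in> {T<..2 * T}. int q ^ k dvd quartic_form a b (r + 32 * int t)} = {}")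
  case False
  let ?m = "int q ^ k"
  let ?A = "{t \<in> {T<..2 * T}. ?m dvd quartic_form a b (r + 32 * int t)}"
  define X where "X = (\<lambda>t. r + 32 * int t)"
  obtain s where s: "s \<in> ?A" using False by blast
  define x where "x = X s"
  have c2: "coprime (int q) 2" using q by (simp add: coprime_commute)
  then have c32: "coprime ?m 32"
    using coprime_power_right_iff[of ?m 2 5] by simp
  have q2: "\<not> int q dvd 2" using c2 q(1) by (metis coprime_common_divisor dvd_refl not_prime_unit prime_nat_int_transfer)
  have X_diff: "?m dvd int t - int t'" if "?m dvd X t - X t'" for t t'
  proof -
    have "X t - X t' = 32 * (int t - int t')" by (simp add: X_def)
    then show ?thesis using that c32 coprime_dvd_mult_right_iff by metis
  qed
  have m0: "q ^ k > 0" using q prime_gt_0_nat by simp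
  define R where "R = (\<lambda>c d. {t \<in> ?A. ?m dvd c * X t + d})"
  have card1: "card (R c d) \<le> T div q ^ k + 1"
    if "\<not> (int q dvd c \<and> int q dvd d)" for c d
    unfolding R_def
  proof (rule card_le_of_dvd_diff)
    show "int (q ^ k) dvd int t - int t'"
      if "t \<in> {t \<in> ?A. ?m dvd c * X t + d}" "t' \<in> {t \<in> ?A. ?m dvd c * X t + d}" for t t'
      using prime_power_dvd_linear_unique[OF q(1) k(1), of c "X t" d "X t'"] that X_diff
        \<open>\<not> (int q dvd c \<and> int q dvd d)\<close> by auto
  qed (use m0 in auto)
  have one: "\<not> int q dvd 1" using q(1) by (metis not_prime_unit prime_nat_int_transfer)
  have pm1: "\<not> (int q dvd x + c \<and> int q dvd x + d)" if "d - c = 2 \<or> d - c = - 2" for c d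
  proof
    assume "int q dvd x + c \<and> int q dvd x + d"
    then have "int q dvd (x + d) - (x + c)" using dvd_diff by blast
    then show False using that q2 by auto
  qed
  \<comment> \<open>The four sets belong to \<open>x * y + 1\<close>, \<open>y - x\<close>, their
    difference and their sum, each written in the form \<open>c * y + d\<close>.\<close>
  have sub: "?A \<subseteq> R x 1 \<union> R 1 (- x) \<union>
      R (x + (-1)) (x + 1) \<union> R (x + 1) (1 - x)"
  proof
    fix t assume t: "t \<in> ?A"
    define y where "y = X t"
    have det: "?m dvd quartic_det x y"
      by (rule dvd_quartic_det[OF coprime_of_prime_norm[OF p]]) (use s t in \<open>auto simp: x_def y_def X_def\<close>)
    \<comment> \<open>If \<open>q\<close> divided both \<open>x * y + 1\<close> and
      \<open>y - x\<close>, it would divide \<open>x\<^sup>2 + 1\<close> and thus the norm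
      \<open>p\<close>.\<close>
    have "k = 1 \<or> \<not> (int q dvd x * y + 1 \<and> int q dvd y - x)"
    proof (cases "k = 1")
      case False
      then have "q \<noteq> p" using k by blast
      have "\<not> (int q dvd x * y + 1 \<and> int q dvd y - x)"
      proof
        assume "int q dvd x * y + 1 \<and> int q dvd y - x"
        then have "int q dvd (x * y + 1) - x * (y - x)" by simp
        then have "int q dvd x\<^sup>2 + 1" by (simp add: algebra_simps power2_eq_square)
        moreover have "int q dvd quartic_form a b x"
          using s k(1) by (auto simp: x_def X_def intro: dvd_trans[OF dvd_power])
        ultimately have "int q dvd a\<^sup>2 + b\<^sup>2" using dvd_quartic_form_imp_dvd_norm[OF q] by blast
        then show False using p q \<open>q \<noteq> p\<close> by (simp add: primes_dvd_imp_eq)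
      qed
      then show ?thesis by blast
    qed blast
    from prime_power_dvd_quartic_det[OF q det this] show "t \<in> R x 1 \<union> R 1 (- x) \<union>
      R (x + (-1)) (x + 1) \<union> R (x + 1) (1 - x)"
      using t unfolding y_def R_def by (auto simp: algebra_simps)
  qed
  have c1: "card (R x 1) \<le> T div q ^ k + 1" using card1[of x 1] one by blast
  have c2: "card (R 1 (- x)) \<le> T div q ^ k + 1" using card1[of 1 "- x"] one by blast
  have c3: "card (R (x + (-1)) (x + 1)) \<le> T div q ^ k + 1"
    using card1[of "x + (-1)" "x + 1"] pm1[of 1 "-1"] by simp
  have c4: "card (R (x + 1) (1 - x)) \<le> T div q ^ k + 1"
    using card1[of "x + 1" "1 - x"] pm1[of "-1" 1] dvd_minus_iff[of "int q" "x - 1"] by simp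
  have "card ?A \<le> card (R x 1 \<union> R 1 (- x) \<union> R (x + (-1)) (x + 1) \<union> R (x + 1) (1 - x))"
    by (rule card_mono[OF _ sub]) (auto simp: R_def)
  also have "\<dots> \<le> 4 * (T div q ^ k + 1)" by (rule card_Un4_le[OF c1 c2 c3 c4])
  finally show ?thesis .
next
  case True
  show ?thesis unfolding True by simp
qed

subsection \<open>The size of the quartic form\<close>

text \<open>The form takes the value \<open>b\<close> at 0 and \<open>24 * a - 7 * b\<close> at 2.
  If 32 divides \<open>b\<close>, then \<open>a\<close> is odd and the second value is not divisible
  by 32; steps of 32 do not change this.\<close>

lemma quartic_form_not_dvd_32:
  assumes "odd (a\<^sup>2 + b\<^sup>2)"
  obtains r where "r = 0 \<or> r = 2" "\<And>t. \<not> 32 dvd quartic_form a b (r + 32 * t)"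
proof -
  have cong: "[quartic_form a b (r + 32 * t) = quartic_form a b r] (mod 32)" for r t
    unfolding quartic_form_def
    by (intro cong_add cong_mult cong_diff cong_pow cong_refl) (auto simp: cong_iff_dvd_diff)
  then have dvd: "32 dvd quartic_form a b (r + 32 * t) \<longleftrightarrow> 32 dvd quartic_form a b r" for r t
    by (rule cong_dvd_iff)
  show thesis
  proof (cases "32 dvd b")
    case False
    then show thesis using dvd[of 0] by (intro that[of 0]) (auto simp: quartic_form_def)
  next
    case True
    then have "odd a" using assms by auto
    then have "\<not> 32 dvd 24 * a - 7 * b" using True by presburger
    then show thesis using dvd[of 2] by (intro that[of 2]) (auto simp: quartic_form_def algebra_simps)
  qed
qed

lemma abs_quartic_coeffs_le:
  fixes x :: int
  assumes "x \<ge> 0"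
  shows "\<bar>x ^ 4 - 6 * x ^ 2 + 1\<bar> + \<bar>4 * x ^ 3 - 4 * x\<bar> \<le> (x + 1) ^ 4"
proof -
  have "(x + 1) ^ 4 = x ^ 4 + 4 * x ^ 3 + 6 * x ^ 2 + 4 * x + 1"
    by (simp add: eval_nat_numeral algebra_simps)
  moreover have "x ^ 4 \<ge> 0" "x ^ 3 \<ge> 0" "x ^ 2 \<ge> 0" using assms by auto
  ultimately show ?thesis using assms by linarith
qed

lemma abs_quartic_form_le:
  assumes "x \<ge> 0" "a\<^sup>2 + b\<^sup>2 = int p"
  shows "real_of_int \<bar>quartic_form a b x\<bar> \<le> sqrt p * (x + 1) ^ 4"
proof -
  have ab: "\<bar>real_of_int a\<bar> \<le> sqrt p" "\<bar>real_of_int b\<bar> \<le> sqrt p"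
  proof -
    have eq: "(real_of_int a)\<^sup>2 + (real_of_int b)\<^sup>2 = real p"
      using assms(2) by (metis of_int_add of_int_of_nat_eq of_int_power)
    have "\<bar>real_of_int a\<bar> = sqrt ((real_of_int a)\<^sup>2)" by simp
    also have "\<dots> \<le> sqrt p" unfolding eq[symmetric] by (rule real_sqrt_le_mono) simp
    finally show "\<bar>real_of_int a\<bar> \<le> sqrt p" .
    have "\<bar>real_of_int b\<bar> = sqrt ((real_of_int b)\<^sup>2)" by simp
    also have "\<dots> \<le> sqrt p" unfolding eq[symmetric] by (rule real_sqrt_le_mono) simp
    finally show "\<bar>real_of_int b\<bar> \<le> sqrt p" .
  qed
  define u v where "u = x ^ 4 - 6 * x ^ 2 + 1" and "v = 4 * x ^ 3 - 4 * x"
  have "\<bar>real_of_int (quartic_form a b x)\<bar> = \<bar>real_of_int b * real_of_int u + real_of_int a * real_of_int v\<bar>"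
    by (simp only: quartic_form_def u_def v_def of_int_add of_int_mult)
  also have "\<dots> \<le> \<bar>real_of_int b\<bar> * \<bar>real_of_int u\<bar> + \<bar>real_of_int a\<bar> * \<bar>real_of_int v\<bar>"
    by (metis abs_mult abs_triangle_ineq)
  also have "\<dots> \<le> sqrt p * \<bar>real_of_int u\<bar> + sqrt p * \<bar>real_of_int v\<bar>"
    by (intro add_mono mult_right_mono ab) auto
  also have "\<dots> = sqrt p * real_of_int (\<bar>u\<bar> + \<bar>v\<bar>)" by (simp add: algebra_simps)
  also have "\<dots> \<le> sqrt p * real_of_int ((x + 1) ^ 4)"
    using abs_quartic_coeffs_le[OF assms(1)] unfolding u_def v_def
    by (intro mult_left_mono) (simp_all only: of_int_le_iff real_sqrt_ge_0_iff of_nat_0_le_iff)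
  finally show ?thesis by simp
qed

text \<open>The gap \<open>y - x\<close> is at least 32 but small against \<open>x * y\<close>, so
  the factors \<open>x * y + 1\<close> and \<open>x * y + 1\<close> plus or minus the gap are all of
  order \<open>T\<^sup>2\<close>.\<close>

lemma quartic_det_ge:
  assumes "T \<ge> 1" "x \<ge> 32 * T" "y \<ge> 32 * T" "y - x \<ge> 32" "y - x \<le> 32 * T"
  shows "quartic_det x y \<ge> 2 ^ 35 * T ^ 6"
proof -
  define P Q where "P = x * y + 1" and "Q = y - x"
  have P: "P \<ge> 1024 * T\<^sup>2"
  proof -
    have "(32 * T) * (32 * T) \<le> x * y" using assms by (intro mult_mono) auto
    then show ?thesis by (simp add: P_def power2_eq_square)
  qed
  have "T \<le> T\<^sup>2" using assms by (intro self_le_power) auto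
  then have PQ: "P - Q \<ge> 512 * T\<^sup>2" "P + Q \<ge> 512 * T\<^sup>2"
    using P assms unfolding Q_def by linarith+
  moreover have "T\<^sup>2 \<ge> 0" by simp
  ultimately have nonneg: "P \<ge> 0" "P - Q \<ge> 0" "P + Q \<ge> 0" "Q \<ge> 32"
    using P assms unfolding Q_def by linarith+
  have "4 * ((1024 * T\<^sup>2) * 32 * ((512 * T\<^sup>2) * (512 * T\<^sup>2))) \<le> 4 * (P * Q * ((P - Q) * (P + Q)))"
    using P PQ nonneg by (intro mult_left_mono mult_mono mult_nonneg_nonneg) auto
  moreover have "4 * ((1024 * T\<^sup>2) * 32 * ((512 * T\<^sup>2) * (512 * T\<^sup>2))) = 2 ^ 35 * T ^ 6"
    by (simp add: eval_nat_numeral)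
  ultimately show ?thesis by (simp add: quartic_det_def P_def Q_def)
qed

text \<open>If both values were small, Cramer's rule would make \<open>a\<close> and
  \<open>b\<close> small against the large determinant, contradicting that
  \<open>\<bar>a\<bar> + \<bar>b\<bar>\<close> is at least the square root of
  \<open>p\<close>.\<close>

lemma quartic_form_max_ge:
  fixes T :: int
  assumes "T \<ge> 1" "x \<ge> 32 * T" "y \<ge> 32 * T" "x \<le> 66 * T" "y \<le> 66 * T" "y - x \<ge> 32" "y - x \<le> 32 * T"
    and ab: "a\<^sup>2 + b\<^sup>2 = int p"
    and h: "\<bar>quartic_form a b x\<bar> \<le> h" "\<bar>quartic_form a b y\<bar> \<le> h"
  shows "sqrt p * (real_of_int T)\<^sup>2 \<le> real_of_int h"
proof -
  define D where "D = quartic_det x y"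
  have D: "D \<ge> 2 ^ 35 * T ^ 6" unfolding D_def by (rule quartic_det_ge) (use assms in auto)
  have coeffs: "\<bar>x ^ 4 - 6 * x ^ 2 + 1\<bar> + \<bar>4 * x ^ 3 - 4 * x\<bar> \<le> (67 * T) ^ 4"
    if "x \<ge> 32 * T" "x \<le> 66 * T" for x
  proof -
    have "\<bar>x ^ 4 - 6 * x ^ 2 + 1\<bar> + \<bar>4 * x ^ 3 - 4 * x\<bar> \<le> (x + 1) ^ 4"
      using that assms(1) by (intro abs_quartic_coeffs_le) auto
    also have "\<dots> \<le> (67 * T) ^ 4" using that assms(1) by (intro power_mono) auto
    finally show ?thesis .
  qed
  have tri: "\<bar>A * v - B * u\<bar> \<le> h * \<bar>v\<bar> + h * \<bar>u\<bar>" if "\<bar>A\<bar> \<le> h" "\<bar>B\<bar> \<le> h" for A B u v :: int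
  proof -
    have "\<bar>A * v - B * u\<bar> \<le> \<bar>A\<bar> * \<bar>v\<bar> + \<bar>B\<bar> * \<bar>u\<bar>" by (metis abs_mult abs_triangle_ineq4)
    also have "\<dots> \<le> h * \<bar>v\<bar> + h * \<bar>u\<bar>" using that by (intro add_mono mult_right_mono) auto
    finally show ?thesis .
  qed
  have "\<bar>a * D\<bar> \<le> h * \<bar>y ^ 4 - 6 * y ^ 2 + 1\<bar> + h * \<bar>x ^ 4 - 6 * x ^ 2 + 1\<bar>"
    unfolding D_def quartic_det_left[of a x y b] by (rule tri[OF h])
  moreover have "\<bar>b * D\<bar> \<le> h * \<bar>4 * x ^ 3 - 4 * x\<bar> + h * \<bar>4 * y ^ 3 - 4 * y\<bar>"
    unfolding D_def quartic_det_right[of b x y a] by (rule tri[OF h(2,1)])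
  ultimately have "\<bar>a * D\<bar> + \<bar>b * D\<bar> \<le>
      h * (\<bar>y ^ 4 - 6 * y ^ 2 + 1\<bar> + \<bar>4 * y ^ 3 - 4 * y\<bar>) + h * (\<bar>x ^ 4 - 6 * x ^ 2 + 1\<bar> + \<bar>4 * x ^ 3 - 4 * x\<bar>)"
    unfolding distrib_left by linarith
  also have "\<dots> \<le> h * (67 * T) ^ 4 + h * (67 * T) ^ 4"
    using h assms by (intro add_mono mult_left_mono coeffs) auto
  finally have le: "(\<bar>a\<bar> + \<bar>b\<bar>) * \<bar>D\<bar> \<le> 2 * h * (67 * T) ^ 4" by (simp add: abs_mult algebra_simps)
  have sqrt_le: "sqrt p \<le> real_of_int (\<bar>a\<bar> + \<bar>b\<bar>)"
  proof (rule real_le_lsqrt)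
    have "int p \<le> (\<bar>a\<bar> + \<bar>b\<bar>)\<^sup>2" unfolding ab[symmetric] by (simp add: power2_sum)
    then show "real p \<le> (real_of_int (\<bar>a\<bar> + \<bar>b\<bar>))\<^sup>2"
      by (metis of_int_le_iff of_int_of_nat_eq of_int_power)
  qed auto
  have "sqrt p * (2 ^ 35 * real_of_int T ^ 6) \<le> real_of_int (\<bar>a\<bar> + \<bar>b\<bar>) * real_of_int \<bar>D\<bar>"
  proof (intro mult_mono sqrt_le)
    have "real_of_int (2 ^ 35 * T ^ 6) \<le> real_of_int \<bar>D\<bar>" using D by (subst of_int_le_iff) auto
    then show "2 ^ 35 * real_of_int T ^ 6 \<le> real_of_int \<bar>D\<bar>" by simp
  qed (use assms in auto)
  also have "\<dots> \<le> real_of_int (2 * h * (67 * T) ^ 4)" using le by (metis of_int_le_iff of_int_mult)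
  \<comment> \<open>The number is 2 * 67^4; it lies below the constant 2^35 of the determinant
    bound.\<close>
  also have "\<dots> = h * (40302242 * real_of_int T ^ 4)" by (simp add: power_mult_distrib)
  also have "\<dots> \<le> h * (2 ^ 35 * real_of_int T ^ 4)" using h assms by (intro mult_left_mono mult_right_mono) auto
  finally have "(sqrt p * (real_of_int T)\<^sup>2) * (2 ^ 35 * real_of_int T ^ 4) \<le> h * (2 ^ 35 * real_of_int T ^ 4)"
    by (simp add: eval_nat_numeral mult_ac)
  then show ?thesis using assms(1) by (subst (asm) mult_le_cancel_right_pos) auto
qed

subsection \<open>Sums over primes\<close>

lemma ln_eq_sum_multiplicity:
  assumes "n > 0"
  shows "ln (real n) = (\<Sum>q\<in>prime_factors n. real (multiplicity q n) * ln (real q))"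
proof -
  have "real n = (\<Prod>q\<in>prime_factors n. real q ^ multiplicity q n)"
    using prime_factorization_nat[OF assms] by (metis (no_types, lifting) of_nat_power of_nat_prod prod.cong)
  also have "ln \<dots> = (\<Sum>q\<in>prime_factors n. ln (real q ^ multiplicity q n))"
    by (rule ln_prod) (auto intro!: zero_less_power simp: in_prime_factors_iff prime_gt_0_nat)
  also have "\<dots> = (\<Sum>q\<in>prime_factors n. real (multiplicity q n) * ln (real q))"
    by (rule sum.cong) (auto simp: ln_realpow in_prime_factors_iff prime_gt_0_nat)
  finally show ?thesis .
qed

lemma ln_eq_sum_multiplicity_superset:
  assumes "n > 0" "finite A" "prime_factors n \<subseteq> A" "\<And>q. q \<in> A \<Longrightarrow> prime q"
  shows "ln (real n) = (\<Sum>q\<in>A. real (multiplicity q n) * ln (real q))"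
  unfolding ln_eq_sum_multiplicity[OF assms(1)]
proof (rule sum.mono_neutral_left[OF assms(2,3)], rule ballI)
  fix q assume "q \<in> A - prime_factors n"
  then have "\<not> q dvd n" using assms(1,4) by (auto simp: in_prime_factors_iff)
  then show "real (multiplicity q n) * ln (real q) = 0" by (simp add: not_dvd_imp_multiplicity_0)
qed

text \<open>A Chebyshev-type argument: counting the primes dividing the numbers 1 to
  \<open>n\<close> bounds the sum of \<open>(n div q) * ln q\<close> by \<open>n * ln n\<close>.
  Since \<open>q \<le> n\<close>, rounding down \<open>n / q\<close> loses at most a factor
  2.\<close>

lemma sum_ln_prime_over_prime_le:
  assumes "n \<ge> 1"
  shows "(\<Sum>q | prime q \<and> q \<le> n. ln (real q) / real q) \<le> 2 * ln (real n)"
proof -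
  let ?P = "{q. prime q \<and> q \<le> n}"
  have fin: "finite ?P" by simp
  have "(\<Sum>q\<in>?P. real (n div q) * ln (real q)) \<le> (\<Sum>q\<in>?P. \<Sum>m\<in>{1..n}. if q dvd m then ln (real q) else 0)"
  proof (rule sum_mono)
    fix q assume q: "q \<in> ?P"
    then have q0: "q > 0" using prime_gt_0_nat by blast
    have "(\<lambda>k. q * k) ` {1..n div q} \<subseteq> {m\<in>{1..n}. q dvd m}"
    proof (rule image_subsetI)
      fix k assume k: "k \<in> {1..n div q}"
      then have "q * k \<le> q * (n div q)" by simp
      also have "\<dots> \<le> n" by simp
      finally show "q * k \<in> {m\<in>{1..n}. q dvd m}" using k q0 by simp
    qed
    then have "card ((\<lambda>k. q * k) ` {1..n div q}) \<le> card {m\<in>{1..n}. q dvd m}"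
      by (intro card_mono) auto
    moreover have "card ((\<lambda>k. q * k) ` {1..n div q}) = n div q"
      using q0 by (subst card_image) (auto simp: inj_on_def)
    ultimately have "real (n div q) * ln (real q) \<le> real (card {m\<in>{1..n}. q dvd m}) * ln (real q)"
      using q0 by (intro mult_right_mono) auto
    also have "\<dots> = (\<Sum>m\<in>{1..n}. if q dvd m then ln (real q) else 0)"
      by (simp add: sum.inter_filter[symmetric])
    finally show "real (n div q) * ln (real q) \<le> (\<Sum>m\<in>{1..n}. if q dvd m then ln (real q) else 0)" .
  qed
  also have "\<dots> = (\<Sum>m\<in>{1..n}. \<Sum>q\<in>?P. if q dvd m then ln (real q) else 0)" by (rule sum.swap)
  also have "\<dots> \<le> (\<Sum>m\<in>{1..n}. ln (real n))"
  proof (rule sum_mono)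
    fix m assume m: "m \<in> {1..n}"
    have sub: "prime_factors m \<subseteq> ?P"
    proof
      fix q assume "q \<in> prime_factors m"
      then have "prime q" "q dvd m" by (auto simp: in_prime_factors_iff)
      moreover from this have "q \<le> m" using m by (intro dvd_imp_le) auto
      ultimately show "q \<in> ?P" using m by simp
    qed
    have "(\<Sum>q\<in>?P. if q dvd m then ln (real q) else 0) \<le> (\<Sum>q\<in>?P. real (multiplicity q m) * ln (real q))"
    proof (rule sum_mono)
      fix q assume q: "q \<in> ?P"
      then have "ln (real q) \<ge> 0" using prime_gt_0_nat[of q] by simp
      moreover have "multiplicity q m \<ge> 1" if "q dvd m"
        using that m q multiplicity_gt_zero_iff[of m q] prime_gt_1_nat[of q] by auto
      ultimately show "(if q dvd m then ln (real q) else 0) \<le> real (multiplicity q m) * ln (real q)"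
        using mult_right_mono[of 1 "real (multiplicity q m)" "ln (real q)"] by auto
    qed
    also have "\<dots> = ln (real m)"
      using m by (intro ln_eq_sum_multiplicity_superset[symmetric] sub) auto
    also have "\<dots> \<le> ln (real n)" using m by simp
    finally show "(\<Sum>q\<in>?P. if q dvd m then ln (real q) else 0) \<le> ln (real n)" .
  qed
  also have "\<dots> = n * ln (real n)" by simp
  finally have *: "(\<Sum>q\<in>?P. real (n div q) * ln (real q)) \<le> n * ln (real n)" .
  have "(real n / 2) * (\<Sum>q\<in>?P. ln (real q) / real q) = (\<Sum>q\<in>?P. (real n / (2 * real q)) * ln (real q))"
    by (simp add: sum_distrib_left field_simps)
  also have "\<dots> \<le> (\<Sum>q\<in>?P. real (n div q) * ln (real q))"
  proof (rule sum_mono)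
    fix q assume q: "q \<in> ?P"
    then have q0: "q > 0" "n div q \<ge> 1" using prime_gt_0_nat by (auto simp: div_greater_zero_iff Suc_le_eq)
    have "n < q * (n div q + 1)" using q0 dividend_less_times_div by fastforce
    also have "\<dots> \<le> q * (2 * (n div q))" using q0 by (intro mult_left_mono) auto
    finally have "real n \<le> real (q * (2 * (n div q)))" by linarith
    then have "real n / (2 * real q) \<le> real (n div q)" using q0 by (simp add: field_simps)
    then show "(real n / (2 * real q)) * ln (real q) \<le> real (n div q) * ln (real q)"
      using q0 by (intro mult_right_mono) auto
  qed
  also note *
  finally show ?thesis using assms by (simp add: field_simps)
qed

lemma ln_over_antimono:
  assumes "3 \<le> x" "x \<le> (y::real)"
  shows "ln y / y \<le> ln x / x"
proof (rule DERIV_nonpos_imp_nonincreasing[OF assms(2)])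
  fix z assume z: "x \<le> z" "z \<le> y"
  have "ln z \<ge> 1"
  proof -
    have "exp (1::real) \<le> z" using exp_le z assms by linarith
    then show ?thesis using z assms by (metis exp_gt_zero ln_exp ln_le_cancel_iff order_less_le_trans)
  qed
  then have "((\<lambda>z. ln z / z) has_real_derivative (1 - ln z) / z ^ 2) (at z)" "(1 - ln z) / z ^ 2 \<le> 0"
    using z assms by (auto intro!: derivative_eq_intros divide_nonpos_pos simp: power2_eq_square)
  then show "\<exists>d. ((\<lambda>z. ln z / z) has_real_derivative d) (at z) \<and> d \<le> 0" by blast
qed

text \<open>The bound depends only on the number of primes. Those up to \<open>n\<close> are covered
  by the previous estimate; each of the at most \<open>n\<close> larger ones contributes at most
  \<open>ln n / n\<close>, since \<open>ln x / x\<close> decreases from 3 on.\<close>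

lemma sum_ln_over_primes_le:
  assumes "finite S" "\<And>q. q \<in> S \<Longrightarrow> prime q" "card S \<le> n" "n \<ge> 3"
  shows "(\<Sum>q\<in>S. ln (real q) / real q) \<le> 3 * ln (real n)"
proof -
  have "(\<Sum>q\<in>S. ln (real q) / real q) =
      (\<Sum>q\<in>S \<inter> {..n}. ln (real q) / real q) + (\<Sum>q\<in>S - {..n}. ln (real q) / real q)"
    using assms(1) by (metis sum.Int_Diff)
  also have "(\<Sum>q\<in>S \<inter> {..n}. ln (real q) / real q) \<le> (\<Sum>q | prime q \<and> q \<le> n. ln (real q) / real q)"
    using assms(2) by (intro sum_mono2) (auto simp: prime_gt_0_nat Suc_leI)
  also have "\<dots> \<le> 2 * ln (real n)" using assms(4) by (intro sum_ln_prime_over_prime_le) auto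
  also have "(\<Sum>q\<in>S - {..n}. ln (real q) / real q) \<le> (\<Sum>q\<in>S - {..n}. ln (real n) / real n)"
    using assms(4) by (intro sum_mono ln_over_antimono) auto
  also have "\<dots> \<le> real n * (ln (real n) / real n)"
  proof -
    have "card (S - {..n}) \<le> n" using assms(1,3) by (metis card_Diff1_le card_mono Diff_subset order_trans)
    then show ?thesis using assms(4) by (simp del: times_divide_eq_right add: mult_right_mono)
  qed
  also have "\<dots> = ln (real n)" using assms(4) by simp
  finally show ?thesis by simp
qed

lemma sum_inverse_powers_le:
  assumes "(q::real) > 1"
  shows "(\<Sum>k\<in>{1..K}. 1 / q ^ k) \<le> 1 / (q - 1)"
proof -
  have "(\<Sum>k\<in>{1..K}. 1 / q ^ k) = (1 - 1 / q ^ K) / (q - 1)"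
  proof (induction K)
    case (Suc K)
    have "(\<Sum>k\<in>{1..Suc K}. 1 / q ^ k) = (1 - 1 / q ^ K) / (q - 1) + 1 / q ^ Suc K"
      using Suc.IH by simp
    also have "\<dots> = (1 - 1 / q ^ Suc K) / (q - 1)" using assms by (simp add: field_simps)
    finally show ?case .
  qed simp
  also have "\<dots> \<le> 1 / (q - 1)" using assms by (intro divide_right_mono) auto
  finally show ?thesis .
qed

text \<open>A multiplicity counts the exponents \<open>k\<close> with \<open>q ^ k\<close> dividing
  the value. Exchanging the sums, the root counts add up to a geometric series plus 4 for each
  admissible exponent.\<close>

lemma sum_multiplicity_le:
  fixes w :: "nat \<Rightarrow> nat" and M :: real
  assumes "finite A" "prime q" "\<And>t. t \<in> A \<Longrightarrow> 0 < w t \<and> real (w t) \<le> M" "M \<ge> 1"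
    and count: "\<And>k. k > 0 \<Longrightarrow> card {t \<in> A. q ^ k dvd w t} \<le> 4 * (T div q ^ k + 1)"
  shows "(\<Sum>t\<in>A. real (multiplicity q (w t)) * ln (real q)) \<le> 4 * real T * (ln (real q) / (real q - 1)) + 4 * ln M"
proof -
  have q: "q > 1" "ln (real q) > 0" using prime_gt_1_nat[OF assms(2)] by auto
  \<comment> \<open>The integer part of the logarithm of \<open>M\<close> to base \<open>q\<close>:
    no higher power of \<open>q\<close> divides any value.\<close>
  define K where "K = nat \<lfloor>ln M / ln (real q)\<rfloor>"
  have K: "real K * ln (real q) \<le> ln M"
  proof -
    have "real K \<le> ln M / ln (real q)" unfolding K_def using q assms(4) by (simp add: zero_le_divide_iff)
    then show ?thesis using q by (simp add: field_simps)
  qed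
  have mult: "multiplicity q (w t) = (\<Sum>k\<in>{1..K}. if q ^ k dvd w t then 1 else 0)" if "t \<in> A" for t
  proof -
    have iff: "q ^ k dvd w t \<longleftrightarrow> k \<le> multiplicity q (w t)" for k
      using assms(3)[OF that] q by (intro power_dvd_iff_le_multiplicity) auto
    have "q ^ multiplicity q (w t) \<le> w t"
      using iff assms(3)[OF that] by (intro dvd_imp_le) auto
    then have "real q ^ multiplicity q (w t) \<le> M" using assms(3)[OF that] by (metis of_nat_le_iff of_nat_power order_trans)
    then have "ln (real q ^ multiplicity q (w t)) \<le> ln M" using q by (subst ln_le_cancel_iff) (auto intro: less_le_trans[of 0 "real q ^ multiplicity q (w t)"])
    then have "real (multiplicity q (w t)) \<le> ln M / ln (real q)" using q by (simp add: ln_realpow field_simps)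
    then have "multiplicity q (w t) \<le> K" unfolding K_def by (simp add: le_nat_floor)
    then have "{k\<in>{1..K}. q ^ k dvd w t} = {1..multiplicity q (w t)}" unfolding iff by auto
    then show ?thesis by (simp add: sum.inter_filter[symmetric])
  qed
  have "(\<Sum>t\<in>A. multiplicity q (w t)) = (\<Sum>t\<in>A. \<Sum>k\<in>{1..K}. if q ^ k dvd w t then 1 else 0)"
    using mult by (intro sum.cong) auto
  also have "\<dots> = (\<Sum>k\<in>{1..K}. \<Sum>t\<in>A. if q ^ k dvd w t then 1 else 0)" by (rule sum.swap)
  also have "\<dots> = (\<Sum>k\<in>{1..K}. card {t\<in>A. q ^ k dvd w t})"
    using assms(1) by (intro sum.cong) (auto simp: sum.inter_filter[symmetric])
  also have "\<dots> \<le> (\<Sum>k\<in>{1..K}. 4 * (T div q ^ k + 1))" by (intro sum_mono count) auto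
  finally have "real (\<Sum>t\<in>A. multiplicity q (w t)) \<le> real (\<Sum>k\<in>{1..K}. 4 * (T div q ^ k + 1))" by linarith
  also have "\<dots> \<le> (\<Sum>k\<in>{1..K}. 4 * (real T * (1 / real q ^ k)) + 4)"
  proof -
    have "real (4 * (T div q ^ k + 1)) \<le> 4 * (real T * (1 / real q ^ k)) + 4" for k
    proof -
      have "real (T div q ^ k) \<le> real T * (1 / real q ^ k)"
        using of_nat_div_le_of_nat[of T "q ^ k", where ?'a = real] by simp
      then show ?thesis unfolding of_nat_mult of_nat_add distrib_left by linarith
    qed
    then show ?thesis unfolding of_nat_sum by (intro sum_mono)
  qed
  also have "\<dots> = 4 * real T * (\<Sum>k\<in>{1..K}. 1 / real q ^ k) + 4 * real K"
    by (simp add: sum.distrib sum_distrib_left mult.assoc)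
  also have "\<dots> \<le> 4 * real T * (1 / (real q - 1)) + 4 * real K"
    using q by (intro add_mono mult_left_mono sum_inverse_powers_le) auto
  finally have "real (\<Sum>t\<in>A. multiplicity q (w t)) * ln (real q) \<le> (4 * real T * (1 / (real q - 1)) + 4 * real K) * ln (real q)"
    using q by (intro mult_right_mono) auto
  also have "\<dots> \<le> 4 * real T * (ln (real q) / (real q - 1)) + 4 * ln M"
    using K by (simp add: distrib_right)
  finally show ?thesis by (simp add: sum_distrib_right)
qed

subsection \<open>Prime divisors of the values of the quartic form\<close>

text \<open>Two small values would contradict \<open>quartic_form_max_ge\<close>: for
  \<open>T < t \<le> 2 * T\<close> the argument \<open>r + 32 * t\<close> lies between
  \<open>32 * T\<close> and \<open>66 * T\<close>.\<close>

lemma card_small_quartic_form_le_1: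
  assumes T: "T \<ge> 1" and r: "r = 0 \<or> r = 2" and ab: "a\<^sup>2 + b\<^sup>2 = int p"
  shows "card {t \<in> {T<..2 * T}. real_of_int \<bar>quartic_form a b (r + 32 * int t)\<bar> < sqrt p * (real T)\<^sup>2} \<le> 1"
proof -
  let ?f = "\<lambda>t. quartic_form a b (r + 32 * int t)"
  have less: False if t: "t \<in> {T<..2 * T}" "t' \<in> {T<..2 * T}" "t < t'"
    "real_of_int \<bar>?f t\<bar> < sqrt p * (real T)\<^sup>2" "real_of_int \<bar>?f t'\<bar> < sqrt p * (real T)\<^sup>2" for t t'
  proof -
    have "sqrt p * real_of_int (int T) ^ 2 \<le> max \<bar>?f t\<bar> \<bar>?f t'\<bar>"
      by (rule quartic_form_max_ge[OF _ _ _ _ _ _ _ ab, where x = "r + 32 * int t" and y = "r + 32 * int t'"])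
        (use t T r in auto)
    then show False using t(4,5) by (simp add: max_def split: if_splits)
  qed
  show ?thesis
  proof (rule card_le_Suc0_iff_eq[THEN iffD2, folded One_nat_def], goal_cases)
    case 2
    show ?case using less by (metis (mono_tags, lifting) mem_Collect_eq nat_neq_iff)
  qed auto
qed

text \<open>The sum of the logarithms of the values is estimated twice. Their prime divisors are 2
  or counted by \<open>n\<close>, which gives the right-hand side; almost all values are at least
  \<open>sqrt p * (real T)\<^sup>2\<close>, which gives the left-hand side.\<close>

lemma quartic_form_prime_divisors_bound:
  fixes p T n :: nat
  defines "M \<equiv> sqrt p * (67 * real T) ^ 4"
  assumes p: "prime p" "[p = 1] (mod 4)" and T: "T \<ge> 1" and n: "n \<ge> 3"
    and card: "card {q. prime q \<and> odd q \<and> real q \<le> M \<and> biquad_res (qstar q) p} \<le> n"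
  shows "(real T - 4 * (real T / p + 1) - 1) * ln (sqrt p * (real T)\<^sup>2) \<le>
     4 * real T * ln 2 + 18 * real T * ln (real n) + 4 * real n * ln M"
proof -
  define S where "S = {q. prime q \<and> odd q \<and> real q \<le> M \<and> biquad_res (qstar q) p}"
  obtain a b where ab: "a\<^sup>2 + b\<^sup>2 = int p" and recip:
    "\<And>q x. prime q \<Longrightarrow> odd q \<Longrightarrow> q \<noteq> p \<Longrightarrow> int q dvd quartic_form a b x \<Longrightarrow> biquad_res (qstar q) p"
    using ex_quartic_form_reciprocity[OF p] by blast
  have p_odd: "odd p"
  proof -
    have "p mod 4 = 1" using p(2) by (simp add: cong_def)
    then show ?thesis by presburger
  qed
  then have "odd (a\<^sup>2 + b\<^sup>2)" unfolding ab by simp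
  then obtain r where r: "r = 0 \<or> r = 2" and not32: "\<And>t. \<not> 32 dvd quartic_form a b (r + 32 * t)"
    using quartic_form_not_dvd_32 by blast
  define F where "F = (\<lambda>t. quartic_form a b (r + 32 * int t))"
  define w where "w = (\<lambda>t. nat \<bar>F t\<bar>)"
  \<comment> \<open>The reciprocity law excludes \<open>q = p\<close>, so values divisible by
    \<open>p\<close> are left out.\<close>
  define A where "A = {t \<in> {T<..2 * T}. \<not> int p dvd F t}"
  have finA: "finite A" by (simp add: A_def)
  have p1: "real p \<ge> 1" using p(1) prime_gt_0_nat[of p] by simp
  then have sqrt1: "sqrt p \<ge> 1" by simp
  have M1: "M \<ge> 1"
  proof -
    have "1 * 1 \<le> sqrt p * (67 * real T) ^ 4" using T sqrt1 by (intro mult_mono one_le_power) auto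
    then show ?thesis by (simp add: M_def)
  qed
  have dvd_w: "m dvd w t \<longleftrightarrow> int m dvd F t" for m t
    by (simp add: w_def nat_dvd_iff flip: int_dvd_int_iff)
  have w: "0 < w t \<and> real (w t) \<le> M" if t: "t \<in> A" for t
  proof
    have "F t \<noteq> 0" using t by (auto simp: A_def)
    then show "0 < w t" by (simp add: w_def)
    have "real (w t) = real_of_int \<bar>F t\<bar>" by (simp add: w_def)
    also have "\<dots> \<le> sqrt p * real_of_int ((r + 32 * int t) + 1) ^ 4"
      unfolding F_def using abs_quartic_form_le[OF _ ab, of "r + 32 * int t"] r by auto
    also have "\<dots> \<le> M" unfolding M_def
      using t r T by (intro mult_left_mono power_mono) (auto simp: A_def)
    finally show "real (w t) \<le> M" .
  qed
  have S_fin: "finite S"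
    by (rule finite_subset[of _ "{..nat \<lfloor>M\<rfloor>}"]) (auto simp: S_def le_nat_floor)
  have S_prime: "prime q" "odd q" if "q \<in> S" for q using that by (auto simp: S_def)
  have two: "2 \<notin> S" by (auto simp: S_def)
  have factors: "prime_factors (w t) \<subseteq> insert 2 S" if t: "t \<in> A" for t
  proof
    fix q assume "q \<in> prime_factors (w t)"
    then have q: "prime q" "q dvd w t" by (auto simp: in_prime_factors_iff)
    show "q \<in> insert 2 S"
    proof (cases "q = 2")
      case False
      then have "odd q" using q(1) by (metis primes_dvd_imp_eq two_is_prime_nat)
      moreover have "int q dvd F t" using q(2) by (simp add: dvd_w)
      moreover from this have "q \<noteq> p" using t by (auto simp: A_def)
      moreover have "real q \<le> M" using w[OF t] dvd_imp_le[OF q(2)] by linarith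
      ultimately show ?thesis using q recip by (auto simp: S_def F_def)
    qed simp
  qed
  have "(\<Sum>t\<in>A. ln (real (w t))) = (\<Sum>t\<in>A. \<Sum>q\<in>insert 2 S. real (multiplicity q (w t)) * ln (real q))"
    using w factors S_fin S_prime by (intro sum.cong refl ln_eq_sum_multiplicity_superset) auto
  also have "\<dots> = (\<Sum>q\<in>insert 2 S. \<Sum>t\<in>A. real (multiplicity q (w t)) * ln (real q))" by (rule sum.swap)
  also have "\<dots> = (\<Sum>t\<in>A. real (multiplicity 2 (w t)) * ln 2) + (\<Sum>q\<in>S. \<Sum>t\<in>A. real (multiplicity q (w t)) * ln (real q))"
    using S_fin two by simp
  also have "(\<Sum>t\<in>A. real (multiplicity 2 (w t)) * ln 2) \<le> 4 * real T * ln 2"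
  proof -
    have "multiplicity 2 (w t) \<le> 4" if "t \<in> A" for t
    proof (rule ccontr)
      assume "\<not> multiplicity 2 (w t) \<le> 4"
      then have "2 ^ 5 dvd w t" by (intro multiplicity_dvd') auto
      then show False using not32[of "int t"] by (simp add: dvd_w F_def)
    qed
    then have "(\<Sum>t\<in>A. real (multiplicity 2 (w t)) * ln 2) \<le> (\<Sum>t\<in>A. 4 * ln 2)"
      by (intro sum_mono mult_right_mono) auto
    also have "\<dots> = real (card A) * (4 * ln 2)" by simp
    also have "\<dots> \<le> real T * (4 * ln 2)"
    proof -
      have "card A \<le> card {T<..2 * T}" unfolding A_def by (intro card_mono) auto
      then show ?thesis by (intro mult_right_mono) auto
    qed
    finally show ?thesis by simp
  qed
  also have "(\<Sum>q\<in>S. \<Sum>t\<in>A. real (multiplicity q (w t)) * ln (real q)) \<le>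
      (\<Sum>q\<in>S. 6 * real T * (ln (real q) / real q) + 4 * ln M)"
  proof (rule sum_mono)
    fix q assume q: "q \<in> S"
    have q3: "q \<ge> 3" using S_prime[OF q] prime_ge_2_nat[of q] by (cases "q = 2") auto
    have "(\<Sum>t\<in>A. real (multiplicity q (w t)) * ln (real q)) \<le> 4 * real T * (ln (real q) / (real q - 1)) + 4 * ln M"
    proof (rule sum_multiplicity_le[OF finA S_prime(1)[OF q] w M1])
      fix k :: nat assume k: "k > 0"
      show "card {t \<in> A. q ^ k dvd w t} \<le> 4 * (T div q ^ k + 1)"
      proof (cases "q = p")
        case True
        have "\<not> q ^ k dvd w t" if "t \<in> A" for t
        proof
          assume "q ^ k dvd w t"
          then have "q dvd w t" using k dvd_power[of k q] dvd_trans by blast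
          then show False using that True by (simp add: dvd_w A_def)
        qed
        then have empty: "{t \<in> A. q ^ k dvd w t} = {}" by blast
        show ?thesis unfolding empty by simp
      next
        case False
        have "card {t \<in> A. q ^ k dvd w t} \<le> card {t \<in> {T<..2 * T}. int q ^ k dvd quartic_form a b (r + 32 * int t)}"
          by (rule card_mono) (auto simp: A_def dvd_w F_def)
        also have "\<dots> \<le> 4 * (T div q ^ k + 1)"
          by (rule card_quartic_form_roots[OF p(1) ab S_prime[OF q] k]) (use False in simp)
        finally show ?thesis .
      qed
    qed
    also have "4 * real T * (ln (real q) / (real q - 1)) \<le> 4 * real T * (3 / 2 * (ln (real q) / real q))"
    proof (rule mult_left_mono)
      \<comment> \<open>Since \<open>q \<ge> 3\<close>; the factor 3/2 turns 4 into 6, and 6 times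
        the 3 from the sum over primes gives 18.\<close>
      have "1 / (real q - 1) \<le> 3 / 2 * (1 / real q)" using q3 by (simp add: field_simps)
      then have "ln (real q) * (1 / (real q - 1)) \<le> ln (real q) * (3 / 2 * (1 / real q))"
        using q3 by (intro mult_left_mono) auto
      then show "ln (real q) / (real q - 1) \<le> 3 / 2 * (ln (real q) / real q)" by (simp add: mult_ac)
    qed simp
    finally show "(\<Sum>t\<in>A. real (multiplicity q (w t)) * ln (real q)) \<le> 6 * real T * (ln (real q) / real q) + 4 * ln M"
      by simp
  qed
  also have "\<dots> = 6 * real T * (\<Sum>q\<in>S. ln (real q) / real q) + real (card S) * (4 * ln M)"
    by (simp add: sum.distrib sum_distrib_left)
  also have "\<dots> \<le> 6 * real T * (3 * ln (real n)) + real n * (4 * ln M)"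
  proof (intro add_mono mult_left_mono mult_right_mono)
    have cardS: "card S \<le> n" using card by (simp only: S_def)
    then show "real (card S) \<le> real n" by simp
    show "(\<Sum>q\<in>S. ln (real q) / real q) \<le> 3 * ln (real n)"
      by (rule sum_ln_over_primes_le[OF S_fin S_prime(1) cardS n])
  qed (use M1 in auto)
  finally have upper: "(\<Sum>t\<in>A. ln (real (w t))) \<le> 4 * real T * ln 2 + 18 * real T * ln (real n) + 4 * real n * ln M"
    by (simp add: mult_ac)
  define h where "h = sqrt p * (real T)\<^sup>2"
  define B where "B = {t \<in> A. real (w t) < h}"
  have h1: "h \<ge> 1"
  proof -
    have "1 * 1 \<le> sqrt p * (real T)\<^sup>2" using T sqrt1 by (intro mult_mono one_le_power) auto
    then show ?thesis by (simp add: h_def)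
  qed
  have "card B \<le> card {t \<in> {T<..2 * T}. real_of_int \<bar>quartic_form a b (r + 32 * int t)\<bar> < sqrt p * (real T)\<^sup>2}"
    by (rule card_mono) (auto simp: B_def A_def w_def F_def h_def)
  also have "\<dots> \<le> 1" by (rule card_small_quartic_form_le_1[OF T r ab])
  finally have cardB: "card B \<le> 1" .
  have "card {T<..2 * T} \<le> card A + card {t \<in> {T<..2 * T}. int p ^ 1 dvd quartic_form a b (r + 32 * int t)}"
  proof -
    have "{T<..2 * T} = A \<union> {t \<in> {T<..2 * T}. int p ^ 1 dvd quartic_form a b (r + 32 * int t)}"
      by (auto simp: A_def F_def)
    then show ?thesis using card_Un_le by metis
  qed
  also have "card {t \<in> {T<..2 * T}. int p ^ 1 dvd quartic_form a b (r + 32 * int t)} \<le> 4 * (T div p ^ 1 + 1)"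
    by (rule card_quartic_form_roots[OF p(1) ab p(1) p_odd]) auto
  finally have "real T \<le> real (card A + 4 * (T div p + 1))" by (subst of_nat_le_iff) simp
  moreover have "real (T div p) \<le> real T / p" by (rule of_nat_div_le_of_nat)
  ultimately have cardA: "real (card A) \<ge> real T - 4 * (real T / p + 1)" by simp
  have "card A \<le> card (A - B) + card B"
  proof -
    have "A = (A - B) \<union> B" by (auto simp: B_def)
    then show ?thesis using card_Un_le by metis
  qed
  \<comment> \<open>The root count for \<open>q = p\<close>, \<open>k = 1\<close> bounds the values
    lost to \<open>p\<close>; one more may be small.\<close>
  then have cardAB: "real (card (A - B)) \<ge> real T - 4 * (real T / p + 1) - 1" using cardA cardB by linarith
  have "(real T - 4 * (real T / p + 1) - 1) * ln h \<le> real (card (A - B)) * ln h"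
    using cardAB h1 by (intro mult_right_mono) auto
  also have "\<dots> = (\<Sum>t\<in>A - B. ln h)" by simp
  also have "\<dots> \<le> (\<Sum>t\<in>A - B. ln (real (w t)))"
    using h1 by (intro sum_mono) (auto simp: B_def)
  also have "\<dots> \<le> (\<Sum>t\<in>A. ln (real (w t)))"
    using finA w by (intro sum_mono2) (auto simp: B_def Suc_le_eq)
  finally show ?thesis using upper unfolding h_def by linarith
qed

section \<open>Choice of parameters and comparison of exponents\<close>

lemma eventually_exponent_comparison:
  fixes \<epsilon> :: real
  assumes "\<epsilon> > 0"
  shows "eventually (\<lambda>x::real. 400 \<le> x \<and> 2000 \<le> x powr (\<epsilon> / 4) \<and> 3 \<le> x powr (\<epsilon> / 50) \<and>
     4 * ln 2 / ln x + 18 / 50 * \<epsilon> + 800 * x powr (\<epsilon> / 50 - \<epsilon> / 4) * (1/2 + \<epsilon>)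
       < (99/100 - 1000 * x powr (- \<epsilon> / 4)) * (1/2 + \<epsilon> / 2 - 2 * ln 200 / ln x)) at_top"
proof (intro eventually_conj)
  show "eventually (\<lambda>x::real. 400 \<le> x) at_top" by (rule eventually_ge_at_top)
  have powr: "eventually (\<lambda>x::real. c \<le> x powr s) at_top" if "s > 0" "c > 0" for c s
    using eventually_ge_at_top[of "c powr (1 / s)"]
  proof eventually_elim
    case (elim x)
    then have "(c powr (1 / s)) powr s \<le> x powr s" using that by (intro powr_mono2) auto
    then show ?case using that by (simp add: powr_powr)
  qed
  show "eventually (\<lambda>x::real. 2000 \<le> x powr (\<epsilon> / 4)) at_top"
    "eventually (\<lambda>x::real. 3 \<le> x powr (\<epsilon> / 50)) at_top"
    using assms by (auto intro!: powr)
  have inv_ln: "((\<lambda>x. c / ln x) \<longlongrightarrow> 0) at_top" for c :: real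
    by (intro tendsto_divide_0[OF tendsto_const] filterlim_at_top_imp_at_infinity ln_at_top)
  have neg: "((\<lambda>x::real. x powr s) \<longlongrightarrow> 0) at_top" if "s < 0" for s
    using that by (intro tendsto_neg_powr filterlim_ident)
  \<comment> \<open>In the limit the comparison is between 99/100 (1/2 + \<epsilon>/2) and 18/50
    \<epsilon>; the former is larger, and all other terms tend to 0.\<close>
  have "((\<lambda>x. (99/100 - 1000 * x powr (- \<epsilon> / 4)) * (1/2 + \<epsilon> / 2 - 2 * ln 200 / ln x)
        - (4 * ln 2 / ln x + 18 / 50 * \<epsilon> + 800 * x powr (\<epsilon> / 50 - \<epsilon> / 4) * (1/2 + \<epsilon>)))
      \<longlongrightarrow> (99/100 - 1000 * 0) * (1/2 + \<epsilon> / 2 - 0) - (0 + 18 / 50 * \<epsilon> + 800 * 0 * (1/2 + \<epsilon>))) at_top"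
    using assms by (intro tendsto_intros inv_ln neg) auto
  moreover have "(99/100 - 1000 * 0) * (1/2 + \<epsilon> / 2 - 0) - (0 + 18 / 50 * \<epsilon> + 800 * 0 * (1/2 + \<epsilon>)) > 0"
    using assms by simp
  ultimately have "eventually (\<lambda>x. 0 < (99/100 - 1000 * x powr (- \<epsilon> / 4)) * (1/2 + \<epsilon> / 2 - 2 * ln 200 / ln x)
        - (4 * ln 2 / ln x + 18 / 50 * \<epsilon> + 800 * x powr (\<epsilon> / 50 - \<epsilon> / 4) * (1/2 + \<epsilon>))) at_top"
    by (rule order_tendstoD)
  then show "eventually (\<lambda>x. 4 * ln 2 / ln x + 18 / 50 * \<epsilon> + 800 * x powr (\<epsilon> / 50 - \<epsilon> / 4) * (1/2 + \<epsilon>)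
       < (99/100 - 1000 * x powr (- \<epsilon> / 4)) * (1/2 + \<epsilon> / 2 - 2 * ln 200 / ln x)) at_top"
    by eventually_elim simp
qed

text \<open>If there were too few primes, the preceding bound with \<open>T\<close> of order
  \<open>p\<close> to the \<open>\<epsilon> / 4\<close> would, after division by
  \<open>T * ln p\<close>, contradict \<open>comparison\<close>.\<close>

lemma card_biquad_res_qstar_gt:
  fixes \<epsilon> :: real and p :: nat
  assumes "\<epsilon> > 0" and p: "prime p" "[p = 1] (mod 4)"
    and large: "400 \<le> real p" "2000 \<le> real p powr (\<epsilon> / 4)" "3 \<le> real p powr (\<epsilon> / 50)"
    and comparison: "4 * ln 2 / ln p + 18 / 50 * \<epsilon> + 800 * real p powr (\<epsilon> / 50 - \<epsilon> / 4) * (1/2 + \<epsilon>)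
       < (99/100 - 1000 * real p powr (- \<epsilon> / 4)) * (1/2 + \<epsilon> / 2 - 2 * ln 200 / ln p)"
  shows "real (card {q::nat. prime q \<and> odd q \<and> real q < real p powr (1/2 + \<epsilon>) \<and> biquad_res (qstar q) p})
             > real p powr (\<epsilon> / 50)"
proof (rule ccontr)
  define x L Y where "x = real p" and "L = ln x" and "Y = x powr (\<epsilon> / 4)"
  \<comment> \<open>The division by 100 keeps \<open>67 * T\<close> below \<open>Y\<close>, so that
    \<open>M\<close> stays below \<open>p powr (1/2 + \<epsilon>)\<close>; rounding still leaves
    \<open>T \<ge> Y / 200\<close>.\<close>
  define T n where "T = nat \<lfloor>Y / 100\<rfloor>" and "n = nat \<lfloor>x powr (\<epsilon> / 50)\<rfloor>"
  define M where "M = sqrt p * (67 * real T) ^ 4"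
  let ?S = "{q::nat. prime q \<and> odd q \<and> real q < real p powr (1/2 + \<epsilon>) \<and> biquad_res (qstar q) p}"
  assume "\<not> ?thesis"
  then have "real (card ?S) \<le> x powr (\<epsilon> / 50)" by (simp add: x_def)
  then have card_S: "card ?S \<le> n" by (simp add: n_def le_nat_floor)
  have x: "x \<ge> 400" "Y \<ge> 2000" using large by (simp_all add: x_def Y_def)
  have L: "L > 0" using x by (simp add: L_def)
  have T: "real T \<le> Y / 100" "real T > Y / 100 - 1" using x by (simp_all add: T_def) linarith
  then have T': "real T \<ge> Y / 200" using x by linarith
  then have T1: "T \<ge> 1" using x by linarith
  have n: "real n \<le> x powr (\<epsilon> / 50)" "n \<ge> 3"
    using large by (simp_all add: n_def x_def le_nat_floor)
  have lnY: "ln Y = \<epsilon> / 4 * L" by (simp add: Y_def L_def ln_powr)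
  have M_less: "M < x powr (1/2 + \<epsilon>)"
  proof -
    have "(67 * real T) ^ 4 < Y ^ 4" using T x by (intro power_strict_mono) auto
    then have "M < sqrt x * Y ^ 4" using x by (simp add: M_def x_def)
    also have "Y ^ 4 = x powr \<epsilon>" using x by (simp add: Y_def powr_power)
    also have "sqrt x * x powr \<epsilon> = x powr (1/2 + \<epsilon>)" using x by (simp add: powr_add powr_half_sqrt)
    finally show ?thesis .
  qed
  have M_pos: "M > 0" using T1 x by (simp add: M_def x_def)
  have ln_M: "ln M \<le> (1/2 + \<epsilon>) * L"
  proof -
    have "ln M \<le> ln (x powr (1/2 + \<epsilon>))" using M_less M_pos by (subst ln_le_cancel_iff) auto
    then show ?thesis by (simp add: ln_powr L_def)
  qed
  have ln_n: "ln (real n) \<le> \<epsilon> / 50 * L"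
  proof -
    have "ln (real n) \<le> ln (x powr (\<epsilon> / 50))" using n x by (subst ln_le_cancel_iff) auto
    then show ?thesis by (simp add: ln_powr L_def)
  qed
  have "card {q. prime q \<and> odd q \<and> real q \<le> M \<and> biquad_res (qstar q) p} \<le> card ?S"
  proof (rule card_mono)
    show "finite ?S"
      by (rule finite_subset[of _ "{..nat \<lfloor>x powr (1/2 + \<epsilon>)\<rfloor>}"]) (auto simp: x_def le_nat_floor)
    show "{q. prime q \<and> odd q \<and> real q \<le> M \<and> biquad_res (qstar q) p} \<subseteq> ?S"
      using M_less by (auto simp: x_def)
  qed
  then have card_M: "card {q. prime q \<and> odd q \<and> real q \<le> M \<and> biquad_res (qstar q) p} \<le> n"
    using card_S by linarith
  have bound: "(real T - 4 * (real T / x + 1) - 1) * ln (sqrt x * (real T)\<^sup>2) \<le>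
     4 * real T * ln 2 + 18 * real T * ln (real n) + 4 * real n * ln M"
    using quartic_form_prime_divisors_bound[OF p T1 n(2)] card_M unfolding M_def x_def by blast
  have lower: "real T * L * ((99/100 - 1000 / Y) * (1/2 + \<epsilon> / 2 - 2 * ln 200 / L))
      \<le> (real T - 4 * (real T / x + 1) - 1) * ln (sqrt x * (real T)\<^sup>2)"
  proof -
    have ln_h: "L * (1/2 + \<epsilon> / 2 - 2 * ln 200 / L) \<le> ln (sqrt x * (real T)\<^sup>2)"
    proof -
      have "ln (sqrt x * (real T)\<^sup>2) = L / 2 + 2 * ln (real T)"
        using T1 x by (simp add: ln_mult ln_sqrt ln_realpow L_def)
      moreover have "ln (Y / 200) \<le> ln (real T)" using T' x by (subst ln_le_cancel_iff) auto
      then have "\<epsilon> / 4 * L - ln 200 \<le> ln (real T)" using x by (simp add: ln_div lnY)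
      ultimately show ?thesis using L by (simp add: algebra_simps)
    qed
    have h0: "0 \<le> ln (sqrt x * (real T)\<^sup>2)"
    proof -
      have "1 * 1 \<le> sqrt x * (real T)\<^sup>2" using T1 x by (intro mult_mono one_le_power) auto
      then show ?thesis by simp
    qed
    have Y1: "0 \<le> 99/100 - 1000 / Y"
    proof -
      have "1000 / Y \<le> 1 / 2" using x by (simp add: field_simps)
      then show ?thesis by simp
    qed
    \<comment> \<open>The loss of \<open>4 * T / x\<close> is at most \<open>T / 100\<close> because
      \<open>x \<ge> 400\<close>; the remaining constant 5 is absorbed by
      \<open>1000 * T / Y\<close>.\<close>
    have "real T * (99/100 - 1000 / Y) \<le> real T - 4 * (real T / x + 1) - 1"
    proof -
      have "real T / x \<le> real T / 400" using x by (intro divide_left_mono) auto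
      moreover have "5 \<le> real T * (1000 / Y)"
      proof -
        have "Y / 200 * (1000 / Y) \<le> real T * (1000 / Y)" using T' x by (intro mult_right_mono) auto
        then show ?thesis using x by simp
      qed
      moreover have "t * (99/100) - d \<le> t - 4 * (u + 1) - 1" if "u \<le> t / 400" "5 \<le> d" for t u d :: real
        using that by (simp add: field_simps)
      ultimately show ?thesis unfolding right_diff_distrib by blast
    qed
    then have "real T * (99/100 - 1000 / Y) * ln (sqrt x * (real T)\<^sup>2)
        \<le> (real T - 4 * (real T / x + 1) - 1) * ln (sqrt x * (real T)\<^sup>2)"
      using h0 by (rule mult_right_mono)
    moreover have "real T * (99/100 - 1000 / Y) * (L * (1/2 + \<epsilon> / 2 - 2 * ln 200 / L))
        \<le> real T * (99/100 - 1000 / Y) * ln (sqrt x * (real T)\<^sup>2)"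
      using Y1 by (intro mult_left_mono ln_h) auto
    ultimately show ?thesis by (simp only: mult_ac)
  qed
  have upper: "4 * real T * ln 2 + 18 * real T * ln (real n) + 4 * real n * ln M
      \<le> real T * L * (4 * ln 2 / L + 18 / 50 * \<epsilon> + 800 * x powr (\<epsilon> / 50 - \<epsilon> / 4) * (1/2 + \<epsilon>))"
  proof -
    have "18 * real T * ln (real n) \<le> 18 * real T * (\<epsilon> / 50 * L)" by (intro mult_left_mono ln_n) auto
    moreover have "4 * real n * ln M \<le> 4 * (real T * (200 * x powr (\<epsilon> / 50 - \<epsilon> / 4))) * ((1/2 + \<epsilon>) * L)"
    proof -
      \<comment> \<open>As \<open>T \<ge> Y / 200\<close>, the count \<open>n\<close> is smaller
        than \<open>T\<close> by a negative power of \<open>x\<close>, up to the factor 200; with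
        the coefficient 4 this yields 800.\<close>
      have n_T: "real n \<le> real T * (200 * x powr (\<epsilon> / 50 - \<epsilon> / 4))"
      proof -
        have "Y * x powr (\<epsilon> / 50 - \<epsilon> / 4) = x powr (\<epsilon> / 4 + (\<epsilon> / 50 - \<epsilon> / 4))"
          unfolding Y_def by (rule powr_add[symmetric])
        then have "x powr (\<epsilon> / 50) = Y / 200 * (200 * x powr (\<epsilon> / 50 - \<epsilon> / 4))" by simp
        also have "\<dots> \<le> real T * (200 * x powr (\<epsilon> / 50 - \<epsilon> / 4))" using T' by (intro mult_right_mono) auto
        finally show ?thesis using n by linarith
      qed
      then have "4 * real n * ln M \<le> 4 * real n * ((1/2 + \<epsilon>) * L)" by (intro mult_left_mono ln_M) auto
      also have "\<dots> \<le> 4 * (real T * (200 * x powr (\<epsilon> / 50 - \<epsilon> / 4))) * ((1/2 + \<epsilon>) * L)"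
        using n_T assms(1) L by (intro mult_right_mono mult_left_mono) auto
      finally show ?thesis .
    qed
    moreover have "real T * L * (4 * ln 2 / L + 18 / 50 * \<epsilon> + 800 * x powr (\<epsilon> / 50 - \<epsilon> / 4) * (1/2 + \<epsilon>)) =
      4 * real T * ln 2 + 18 * real T * (\<epsilon> / 50 * L) + 4 * (real T * (200 * x powr (\<epsilon> / 50 - \<epsilon> / 4))) * ((1/2 + \<epsilon>) * L)"
      using L by (simp add: distrib_left mult_ac)
    ultimately show ?thesis by linarith
  qed
  have "x powr (- \<epsilon> / 4) = 1 / Y" by (simp add: Y_def powr_minus_divide)
  then have "4 * ln 2 / L + 18 / 50 * \<epsilon> + 800 * x powr (\<epsilon> / 50 - \<epsilon> / 4) * (1/2 + \<epsilon>)
      < (99/100 - 1000 / Y) * (1/2 + \<epsilon> / 2 - 2 * ln 200 / L)"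
    using comparison by (simp add: x_def L_def)
  then have "real T * L * (4 * ln 2 / L + 18 / 50 * \<epsilon> + 800 * x powr (\<epsilon> / 50 - \<epsilon> / 4) * (1/2 + \<epsilon>))
      < real T * L * ((99/100 - 1000 / Y) * (1/2 + \<epsilon> / 2 - 2 * ln 200 / L))"
    using T1 L by (intro mult_strict_left_mono) auto
  then show False using lower upper bound by linarith
qed

theorem theorem2:
  shows "\<forall>\<epsilon>::real. \<epsilon> > 0 \<longrightarrow> (\<exists>p0::real. \<forall>p::nat.
           prime p \<and> [p = 1] (mod 4) \<and> real p > p0 \<longrightarrow>
           real (card {q::nat. prime q \<and> odd q \<and> real q < real p powr (1/2 + \<epsilon>) \<and>
                                biquad_res (qstar q) p})
             > real p powr (\<epsilon> / 50))"
proof (intro allI impI)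
  fix \<epsilon> :: real assume \<epsilon>: "\<epsilon> > 0"
  obtain p0 where p0: "\<And>x. x \<ge> p0 \<Longrightarrow> 400 \<le> x \<and> 2000 \<le> x powr (\<epsilon> / 4) \<and> 3 \<le> x powr (\<epsilon> / 50) \<and>
     4 * ln 2 / ln x + 18 / 50 * \<epsilon> + 800 * x powr (\<epsilon> / 50 - \<epsilon> / 4) * (1/2 + \<epsilon>)
       < (99/100 - 1000 * x powr (- \<epsilon> / 4)) * (1/2 + \<epsilon> / 2 - 2 * ln 200 / ln x)"
    using eventually_exponent_comparison[OF \<epsilon>] unfolding eventually_at_top_linorder by blast
  show "\<exists>p0::real. \<forall>p::nat.
           prime p \<and> [p = 1] (mod 4) \<and> real p > p0 \<longrightarrow>
           real (card {q::nat. prime q \<and> odd q \<and> real q < real p powr (1/2 + \<epsilon>) \<and>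
                                biquad_res (qstar q) p})
             > real p powr (\<epsilon> / 50)"
  proof (rule exI[of _ p0], intro allI impI, elim conjE)
    fix p :: nat
    assume p: "prime p" "[p = 1] (mod 4)" and "real p > p0"
    then have "p0 \<le> real p" by simp
    from p0[OF this] show "real (card {q::nat. prime q \<and> odd q \<and> real q < real p powr (1/2 + \<epsilon>) \<and>
        biquad_res (qstar q) p}) > real p powr (\<epsilon> / 50)"
      by (elim conjE) (rule card_biquad_res_qstar_gt[OF \<epsilon> p])
  qed
qed

end
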